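(* Let $K$ be a field and $\mathcal{G}$ an ultragraph. Then the ultragraph Leavitt path algebra $L_K(\mathcal{G})$ is semiprimitive, i.e. its Jacobson radical satisfies $J(L_K(\mathcal{G}))=0$.
   Context: An ultragraph $\mathcal{G}=(G^0,\mathcal{G}^1,r,s)$ consists of a countable set $G^0$ of vertices, a countable set $\mathcal{G}^1$ of edges, and maps $s:\mathcal{G}^1\to G^0$, $r:\mathcal{G}^1\to\mathcal{P}(G^0)\setminus\{\varnothing\}$. A vertex $v$ is regular if $0<|s^{-1}(v)|<\infty$. $\mathcal{G}^0$ denotes the smallest subset of $\mathcal{P}(G^0)$ that contains $\{v\}$ for all $v\in G^0$, contains $r(e)$ for all $e\in\mathcal{G}^1$, and is closed under relative complements, finite unions and finite intersections. For a field $K$, $L_K(\mathcal{G})$ is the (associative, not necessarily unital) $K$-algebra generated by $\{s_e,s_e^*\mid e\in\mathcal{G}^1\}\cup\{p_A\mid A\in\mathcal{G}^0\}$ subject to the relations, for all $A,B\in\mathcal{G}^0$, $e,f\in\mathcal{G}^1$: (1) $p_\varnothing=0$, $p_Ap_B=p_{A\cap B}$, $p_{A\cup B}=p_A+p_B-p_{A\cap B}$; (2) $p_{s(e)}s_e=s_e=s_ep_{r(e)}$ and $p_{r(e)}s_e^*=s_e^*=s_e^*p_{s(e)}$; (3) $s_e^*s_f=\delta_{e,f}p_{r(e)}$; (4) $p_v=\sum_{s(e)=v}s_es_e^*$ for every regular vertex $v$, where $p_v:=p_{\{v\}}$. The Jacobson radical is that of a not necessarily unital ring. *)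

theory Defs
  imports "HOL-Library.Poly_Mapping" "HOL-Library.Countable_Set" "HOL-Algebra.QuotRing"
begin

section \<open>The Jacobson radical of a ring that need not have an identity\<close>

text \<open>
  Rings without identity are represented by the records of HOL-Algebra; the \<open>one\<close> field is
  never consulted and need not lie in the carrier. The left ideals below are ring ideals, not
  subspaces.
\<close>

definition left_ideal :: "'a set \<Rightarrow> ('a, 'm) ring_scheme \<Rightarrow> bool" where
  "left_ideal I R \<longleftrightarrow>
     additive_subgroup I R \<and> (\<forall>a\<in>carrier R. \<forall>x\<in>I. a \<otimes>\<^bsub>R\<^esub> x \<in> I)"

text \<open>
  A left ideal is modular (or regular) if the ring has a right identity modulo it. If the ring
  has an identity, every left ideal is modular.
\<close>

definition modular_left_ideal :: "'a set \<Rightarrow> ('a, 'm) ring_scheme \<Rightarrow> bool" where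
  "modular_left_ideal I R \<longleftrightarrow>
     left_ideal I R \<and> (\<exists>u\<in>carrier R. \<forall>a\<in>carrier R. a \<ominus>\<^bsub>R\<^esub> a \<otimes>\<^bsub>R\<^esub> u \<in> I)"

definition maximal_left_ideal :: "'a set \<Rightarrow> ('a, 'm) ring_scheme \<Rightarrow> bool" where
  "maximal_left_ideal M R \<longleftrightarrow>
     left_ideal M R \<and> M \<noteq> carrier R \<and>
     (\<forall>J. left_ideal J R \<and> M \<subseteq> J \<longrightarrow> J = M \<or> J = carrier R)"

text \<open>The empty intersection is the whole ring, so rings without modular maximal left ideals are radical.\<close>

definition jacobson_radical :: "('a, 'm) ring_scheme \<Rightarrow> 'a set" where
  "jacobson_radical R =
     {x \<in> carrier R. \<forall>M. maximal_left_ideal M R \<and> modular_left_ideal M R \<longrightarrow> x \<in> M}"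

section \<open>Ultragraphs\<close>

record ('v, 'e) ultragraph =
  verts :: "'v set"
  edges :: "'e set"
  range_of :: "'e \<Rightarrow> 'v set"
  source_of :: "'e \<Rightarrow> 'v"

locale ultragraph =
  fixes G :: "('v, 'e) ultragraph"
  assumes countable_verts: "countable (verts G)"
    and countable_edges: "countable (edges G)"
    and source_in_verts: "e \<in> edges G \<Longrightarrow> source_of G e \<in> verts G"
    and range_subset_verts: "e \<in> edges G \<Longrightarrow> range_of G e \<subseteq> verts G"
    and range_nonempty: "e \<in> edges G \<Longrightarrow> range_of G e \<noteq> {}"

definition regular_vertex :: "('v, 'e) ultragraph \<Rightarrow> 'v \<Rightarrow> bool" where
  "regular_vertex G v \<longleftrightarrow>
     v \<in> verts G \<and> finite {e \<in> edges G. source_of G e = v} \<and> {e \<in> edges G. source_of G e = v} \<noteq> {}"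

text \<open>
  The first rule is the empty union; it follows from the others unless there are no vertices.
\<close>

inductive_set gen_verts :: "('v, 'e) ultragraph \<Rightarrow> 'v set set"
  for G :: "('v, 'e) ultragraph" where
  empty: "{} \<in> gen_verts G"
| singleton: "v \<in> verts G \<Longrightarrow> {v} \<in> gen_verts G"
| range: "e \<in> edges G \<Longrightarrow> range_of G e \<in> gen_verts G"
| diff: "A \<in> gen_verts G \<Longrightarrow> B \<in> gen_verts G \<Longrightarrow> A - B \<in> gen_verts G"
| union: "A \<in> gen_verts G \<Longrightarrow> B \<in> gen_verts G \<Longrightarrow> A \<union> B \<in> gen_verts G"
| inter: "A \<in> gen_verts G \<Longrightarrow> B \<in> gen_verts G \<Longrightarrow> A \<inter> B \<in> gen_verts G"

section \<open>Free algebras\<close>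

text \<open>
  Words with concatenation written additively, as \<^theory>\<open>HOL-Library.Poly_Mapping\<close> expects;
  its convolution product then makes \<open>'g word \<Rightarrow>\<^sub>0 'k\<close> the unital free algebra on \<open>'g\<close>.
\<close>

datatype 'g word = Word (letters: "'g list")

instantiation word :: (type) monoid_add
begin

definition zero_word :: "'g word" where "zero_word = Word []"

definition plus_word :: "'g word \<Rightarrow> 'g word \<Rightarrow> 'g word" where
  "plus_word u w = Word (letters u @ letters w)"

instance
  by standard (simp_all add: zero_word_def plus_word_def)

end

definition gen :: "'g \<Rightarrow> 'g word \<Rightarrow>\<^sub>0 'k::field" where
  "gen x = Poly_Mapping.single (Word [x]) 1"

definition scalar :: "'k::field \<Rightarrow> 'g word \<Rightarrow>\<^sub>0 'k" where
  "scalar c = Poly_Mapping.single 0 c"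

text \<open>
  The free algebra without identity on the set \<open>X\<close>: combinations of nonempty words over \<open>X\<close>.
  The value of \<open>one\<close> lies outside the carrier.
\<close>

definition free_alg :: "'k::field itself \<Rightarrow> 'g set \<Rightarrow> ('g word \<Rightarrow>\<^sub>0 'k) ring" where
  "free_alg _ X =
     \<lparr>carrier = {p. \<forall>w\<in>Poly_Mapping.keys p. letters w \<noteq> [] \<and> set (letters w) \<subseteq> X},
      mult = (*), one = 1, zero = 0, add = (+)\<rparr>"

text \<open>The algebra ideal of \<open>free_alg TYPE('k) X\<close> generated by a subset \<open>R\<close> of it.\<close>

inductive_set alg_ideal :: "'g set \<Rightarrow> ('g word \<Rightarrow>\<^sub>0 'k::field) set \<Rightarrow> ('g word \<Rightarrow>\<^sub>0 'k) set"
  for X :: "'g set" and R :: "('g word \<Rightarrow>\<^sub>0 'k) set" where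
  base: "x \<in> R \<Longrightarrow> x \<in> alg_ideal X R"
| zero: "0 \<in> alg_ideal X R"
| add: "x \<in> alg_ideal X R \<Longrightarrow> y \<in> alg_ideal X R \<Longrightarrow> x + y \<in> alg_ideal X R"
| scale: "x \<in> alg_ideal X R \<Longrightarrow> scalar c * x \<in> alg_ideal X R"
| mult_left: "a \<in> carrier (free_alg TYPE('k) X) \<Longrightarrow> x \<in> alg_ideal X R \<Longrightarrow> a * x \<in> alg_ideal X R"
| mult_right: "a \<in> carrier (free_alg TYPE('k) X) \<Longrightarrow> x \<in> alg_ideal X R \<Longrightarrow> x * a \<in> alg_ideal X R"

section \<open>Ultragraph Leavitt path algebras\<close>

datatype ('v, 'e) lpa_gen = Proj "'v set" | Edge 'e | Ghost 'e

definition lpa_gens :: "('v, 'e) ultragraph \<Rightarrow> ('v, 'e) lpa_gen set" where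
  "lpa_gens G = Proj ` gen_verts G \<union> Edge ` edges G \<union> Ghost ` edges G"

abbreviation pr :: "'v set \<Rightarrow> ('v, 'e) lpa_gen word \<Rightarrow>\<^sub>0 'k::field" where
  "pr A \<equiv> gen (Proj A)"

abbreviation ed :: "'e \<Rightarrow> ('v, 'e) lpa_gen word \<Rightarrow>\<^sub>0 'k::field" where
  "ed e \<equiv> gen (Edge e)"

abbreviation gh :: "'e \<Rightarrow> ('v, 'e) lpa_gen word \<Rightarrow>\<^sub>0 'k::field" where
  "gh e \<equiv> gen (Ghost e)"

text \<open>A relation \<open>a = b\<close> is represented by the element \<open>a - b\<close>.\<close>

inductive_set lpa_relations :: "('v, 'e) ultragraph \<Rightarrow> (('v, 'e) lpa_gen word \<Rightarrow>\<^sub>0 'k::field) set"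
  for G :: "('v, 'e) ultragraph" where
  proj_empty: "pr {} \<in> lpa_relations G"
| proj_inter: "A \<in> gen_verts G \<Longrightarrow> B \<in> gen_verts G \<Longrightarrow>
    pr A * pr B - pr (A \<inter> B) \<in> lpa_relations G"
| proj_union: "A \<in> gen_verts G \<Longrightarrow> B \<in> gen_verts G \<Longrightarrow>
    pr (A \<union> B) - (pr A + pr B - pr (A \<inter> B)) \<in> lpa_relations G"
| source_edge: "e \<in> edges G \<Longrightarrow> pr {source_of G e} * ed e - ed e \<in> lpa_relations G"
| edge_range: "e \<in> edges G \<Longrightarrow> ed e * pr (range_of G e) - ed e \<in> lpa_relations G"
| range_ghost: "e \<in> edges G \<Longrightarrow> pr (range_of G e) * gh e - gh e \<in> lpa_relations G"
| ghost_source: "e \<in> edges G \<Longrightarrow> gh e * pr {source_of G e} - gh e \<in> lpa_relations G"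
| ghost_edge: "e \<in> edges G \<Longrightarrow> f \<in> edges G \<Longrightarrow>
    gh e * ed f - (if e = f then pr (range_of G e) else 0) \<in> lpa_relations G"
| regular: "regular_vertex G v \<Longrightarrow>
    pr {v} - (\<Sum>e\<in>{e \<in> edges G. source_of G e = v}. ed e * gh e) \<in> lpa_relations G"

definition leavitt_path_algebra ::
    "'k::field itself \<Rightarrow> ('v, 'e) ultragraph \<Rightarrow> (('v, 'e) lpa_gen word \<Rightarrow>\<^sub>0 'k) set ring" where
  "leavitt_path_algebra K G =
     free_alg K (lpa_gens G) Quot alg_ideal (lpa_gens G) (lpa_relations G)"

end

(*
The algebra acts on functions from the boundary paths of the ultragraph (infinite paths, and finite
paths ending at a singular vertex) to the Laurent polynomials K[t,1/t]: s_e prepends e and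
multiplies by t. Finitely generated pieces of the Boolean algebra of vertex sets can be split until
an element without ghost edges has constant coefficients on each piece, and multiplying by s_e on
the right shortens ghost words; so this action is faithful, already on delta functions of paths.

If a is not 0, some delta function at p has a nonzero image; cutting it down to one path q by a
cylinder idempotent and moving q back to p by the reversed word gives c with
c a delta_p = f delta_p and f a nonzero Laurent polynomial. Each exponent n of f comes from words that
shift delta_p by t^n and t^(-n), so after shifting and scaling, f = 1 or all exponents of f are
positive, and 1 - f is not a unit. But every left multiple of an element of the radical is left
quasi-regular, which would make 1 - f invertible.
*)
theory Submission
  imports Defs "HOL-Library.Stream"
begin

section \<open>Rings without identity\<close>

text \<open>The powers of \<open>t\<close> keep the action faithful. If a cycle \<open>c\<close> at
  \<open>v\<close> has no exits, its infinite repetition is the one boundary path from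
  \<open>v\<close>, and with coefficients in K alone the elements \<open>c\<close> and
  \<open>pr {v}\<close> would act alike. The price is that an eigenvalue may be any Laurent
  polynomial, so the end of the proof needs a non-unit argument and not just a scalar inverse.

  The obstacle to faithfulness is an element \<open>x\<close> with \<open>x * ed e\<close> congruent
  to 0 for every edge \<open>e\<close>. At a regular vertex relation (4) then kills
  \<open>x * pr {v}\<close>, but a singular vertex has no such relation. There the path that stops
  at once serves as a test: every ghost edge annihilates its delta function, so only the ghost-free
  part of \<open>x\<close> is seen. Since \<open>x\<close> involves finitely many ghost edges, just
  finitely many regular vertices need relation (4).

  The algebra need not have an identity, while complements such as \<open>1 - ed e * gh e\<close>
  are indispensable. Calculations therefore take place in the free algebra with identity, modulo the
  ideal of relations; only the last step passes to the quotient.\<close>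

locale nonunital_ring = abelian_group R for R (structure) +
  assumes mult_closed [simp, intro]: "x \<in> carrier R \<Longrightarrow> y \<in> carrier R \<Longrightarrow> x \<otimes> y \<in> carrier R"
    and mult_assoc: "x \<in> carrier R \<Longrightarrow> y \<in> carrier R \<Longrightarrow> z \<in> carrier R \<Longrightarrow>
      (x \<otimes> y) \<otimes> z = x \<otimes> (y \<otimes> z)"
    and distrib_right: "x \<in> carrier R \<Longrightarrow> y \<in> carrier R \<Longrightarrow> z \<in> carrier R \<Longrightarrow>
      (x \<oplus> y) \<otimes> z = x \<otimes> z \<oplus> y \<otimes> z"
    and distrib_left: "x \<in> carrier R \<Longrightarrow> y \<in> carrier R \<Longrightarrow> z \<in> carrier R \<Longrightarrow>
      z \<otimes> (x \<oplus> y) = z \<otimes> x \<oplus> z \<otimes> y"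
begin

lemma zero_mult [simp]:
  assumes "x \<in> carrier R" shows "\<zero> \<otimes> x = \<zero>"
proof -
  have "\<zero> \<otimes> x \<oplus> \<zero> \<otimes> x = \<zero> \<otimes> x \<oplus> \<zero>"
    using distrib_right[of \<zero> \<zero> x] assms by simp
  then show ?thesis using assms by (simp del: r_zero)
qed

lemma mult_zero [simp]:
  assumes "x \<in> carrier R" shows "x \<otimes> \<zero> = \<zero>"
proof -
  have "x \<otimes> \<zero> \<oplus> x \<otimes> \<zero> = x \<otimes> \<zero> \<oplus> \<zero>"
    using distrib_left[of \<zero> \<zero> x] assms by simp
  then show ?thesis using assms by (simp del: r_zero)
qed

lemma minus_mult:
  assumes "x \<in> carrier R" "y \<in> carrier R" shows "(\<ominus> x) \<otimes> y = \<ominus> (x \<otimes> y)"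
proof -
  have "(\<ominus> x) \<otimes> y \<oplus> x \<otimes> y = \<zero>"
    using distrib_right[of "\<ominus> x" x y] assms by (simp add: l_neg)
  then show ?thesis using assms by (simp add: minus_equality)
qed

lemma mult_minus:
  assumes "x \<in> carrier R" "y \<in> carrier R" shows "x \<otimes> (\<ominus> y) = \<ominus> (x \<otimes> y)"
proof -
  have "x \<otimes> (\<ominus> y) \<oplus> x \<otimes> y = \<zero>"
    using distrib_left[of "\<ominus> y" y x] assms by (simp add: l_neg)
  then show ?thesis using assms by (simp add: minus_equality)
qed

lemma left_idealI:
  assumes "I \<subseteq> carrier R" "\<zero> \<in> I" "\<And>x y. x \<in> I \<Longrightarrow> y \<in> I \<Longrightarrow> x \<oplus> y \<in> I"
    "\<And>x. x \<in> I \<Longrightarrow> \<ominus> x \<in> I" "\<And>a x. a \<in> carrier R \<Longrightarrow> x \<in> I \<Longrightarrow> a \<otimes> x \<in> I"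
  shows "left_ideal I R"
  unfolding left_ideal_def additive_subgroup_def
  using assms by (auto intro!: subgroup.intro simp flip: a_inv_def)

lemma left_idealD:
  assumes "left_ideal I R"
  shows "I \<subseteq> carrier R" "\<zero> \<in> I" "\<And>x y. x \<in> I \<Longrightarrow> y \<in> I \<Longrightarrow> x \<oplus> y \<in> I"
    "\<And>x. x \<in> I \<Longrightarrow> \<ominus> x \<in> I" "\<And>a x. a \<in> carrier R \<Longrightarrow> x \<in> I \<Longrightarrow> a \<otimes> x \<in> I"
proof -
  have I: "subgroup I (add_monoid R)" and a: "\<forall>a\<in>carrier R. \<forall>x\<in>I. a \<otimes> x \<in> I"
    using assms by (auto simp: left_ideal_def additive_subgroup_def)
  show "I \<subseteq> carrier R" "\<zero> \<in> I" "\<And>x y. x \<in> I \<Longrightarrow> y \<in> I \<Longrightarrow> x \<oplus> y \<in> I"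
    "\<And>a x. a \<in> carrier R \<Longrightarrow> x \<in> I \<Longrightarrow> a \<otimes> x \<in> I"
    using subgroup.subset[OF I] subgroup.one_closed[OF I] subgroup.m_closed[OF I] a by auto
  show "\<And>x. x \<in> I \<Longrightarrow> \<ominus> x \<in> I"
    using subgroup.m_inv_closed[OF I] by (simp add: a_inv_def)
qed

lemma left_ideal_Union_chain:
  assumes "C \<noteq> {}" "subset.chain {I. left_ideal I R} C"
  shows "left_ideal (\<Union>C) R"
proof (rule left_idealI)
  have C: "\<And>I. I \<in> C \<Longrightarrow> left_ideal I R" and
    tot: "\<And>I J. I \<in> C \<Longrightarrow> J \<in> C \<Longrightarrow> I \<subseteq> J \<or> J \<subseteq> I"
    using assms(2) by (auto simp: subset.chain_def)
  show "\<Union>C \<subseteq> carrier R" using C left_idealD(1) by blast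
  show "\<zero> \<in> \<Union>C" using C left_idealD(2) assms(1) by blast
  show "x \<oplus> y \<in> \<Union>C" if xy: "x \<in> \<Union>C" "y \<in> \<Union>C" for x y
  proof -
    obtain I J where IJ: "I \<in> C" "x \<in> I" "J \<in> C" "y \<in> J" using xy by blast
    then consider "I \<subseteq> J" | "J \<subseteq> I" using tot by blast
    then show ?thesis using IJ C left_idealD(3) by cases blast+
  qed
  show "\<ominus> x \<in> \<Union>C" if "x \<in> \<Union>C" for x using that C left_idealD(4) by blast
  show "a \<otimes> x \<in> \<Union>C" if "a \<in> carrier R" "x \<in> \<Union>C" for a x
    using that C left_idealD(5) by blast
qed

text \<open>With \<open>z = a x\<close>, the elements \<open>b - b z\<close> form a left ideal
  \<open>I\<close> modulo which \<open>z\<close> is a right identity. If \<open>z\<close> were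
  outside \<open>I\<close>, a left ideal \<open>M\<close> containing \<open>I\<close> and maximal
  with respect to avoiding \<open>z\<close> would be modular and maximal, hence would contain
  \<open>x\<close> and so \<open>z\<close>. Thus \<open>z\<close> lies in \<open>I\<close>, which is
  the claimed equation up to a sign.\<close>

lemma jacobson_radical_left_quasiregular:
  assumes x: "x \<in> jacobson_radical R" and a: "a \<in> carrier R"
  shows "\<exists>y\<in>carrier R. y \<oplus> a \<otimes> x = y \<otimes> (a \<otimes> x)"
proof -
  define z where "z = a \<otimes> x"
  have xc: "x \<in> carrier R" using x by (simp add: jacobson_radical_def)
  have z: "z \<in> carrier R" using xc a by (simp add: z_def)
  define I where "I = {b \<ominus> b \<otimes> z | b. b \<in> carrier R}"
  have I: "left_ideal I R"
  proof (rule left_idealI)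
    show "I \<subseteq> carrier R" using z by (auto simp: I_def)
    have "\<zero> = \<zero> \<ominus> \<zero> \<otimes> z"
      using z r_neg[of \<zero>] by (simp only: a_minus_def zero_mult zero_closed)
    then show "\<zero> \<in> I" by (auto simp: I_def)
    show "u \<oplus> v \<in> I" if uv: "u \<in> I" "v \<in> I" for u v
    proof -
      obtain b c where b: "b \<in> carrier R" "c \<in> carrier R"
        and e: "u = b \<ominus> b \<otimes> z" "v = c \<ominus> c \<otimes> z"
        using uv by (auto simp: I_def)
      have "u \<oplus> v = (b \<oplus> c) \<ominus> (b \<oplus> c) \<otimes> z"
        using b z by (simp add: e distrib_right a_minus_def minus_add a_ac)
      then show ?thesis using b by (auto simp: I_def)
    qed
    show "\<ominus> u \<in> I" if u: "u \<in> I" for u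
    proof -
      obtain b where b: "b \<in> carrier R" and e: "u = b \<ominus> b \<otimes> z"
        using u by (auto simp: I_def)
      have "\<ominus> u = (\<ominus> b) \<ominus> (\<ominus> b) \<otimes> z"
        using b z by (simp add: e minus_mult a_minus_def minus_add)
      then show ?thesis using b by (auto simp: I_def)
    qed
    show "c \<otimes> u \<in> I" if c: "c \<in> carrier R" and u: "u \<in> I" for c u
    proof -
      obtain b where b: "b \<in> carrier R" and e: "u = b \<ominus> b \<otimes> z"
        using u by (auto simp: I_def)
      have "c \<otimes> u = (c \<otimes> b) \<ominus> (c \<otimes> b) \<otimes> z"
        using b z c by (simp add: e mult_minus a_minus_def distrib_left mult_assoc)
      then show ?thesis using b c by (auto simp: I_def)
    qed
  qed
  have "z \<in> I"
  proof (rule ccontr)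
    assume zI: "z \<notin> I"
    \<comment> \<open>For left ideals above \<open>I\<close>, avoiding \<open>z\<close> amounts to
      being proper, because \<open>b = (b - b z) + b z\<close>. In this form the condition visibly
      passes to unions of chains.\<close>
    let ?A = "{M. left_ideal M R \<and> I \<subseteq> M \<and> z \<notin> M}"
    have "\<exists>M\<in>?A. \<forall>X\<in>?A. M \<subseteq> X \<longrightarrow> X = M"
    proof (rule subset_Zorn_nonempty)
      show "?A \<noteq> {}" using I zI by blast
      fix C assume C: "C \<noteq> {}" "subset.chain ?A C"
      then have "subset.chain {I. left_ideal I R} C" by (auto simp: subset.chain_def)
      then have "left_ideal (\<Union>C) R" by (rule left_ideal_Union_chain[OF C(1)])
      moreover have "I \<subseteq> \<Union>C" "z \<notin> \<Union>C"
        using C unfolding subset.chain_def by blast+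
      ultimately show "\<Union>C \<in> ?A" by simp
    qed
    then obtain M where "M \<in> ?A" and max: "\<forall>X\<in>?A. M \<subseteq> X \<longrightarrow> X = M" ..
    then have M: "left_ideal M R" "I \<subseteq> M" "z \<notin> M" by auto
    have modI: "b \<ominus> b \<otimes> z \<in> M" if "b \<in> carrier R" for b using M(2) that by (auto simp: I_def)
    have "maximal_left_ideal M R"
      unfolding maximal_left_ideal_def
    proof (intro conjI allI impI)
      show "left_ideal M R" by fact
      show "M \<noteq> carrier R" using z M(3) by blast
      fix J assume J: "left_ideal J R \<and> M \<subseteq> J"
      show "J = M \<or> J = carrier R"
      proof (cases "z \<in> J")
        case False
        then have "J \<in> ?A" using M(2) J by auto
        then show ?thesis using max J by auto
      next
        case True
        have "b \<in> J" if b: "b \<in> carrier R" for b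
        proof -
          have "b = (b \<ominus> b \<otimes> z) \<oplus> b \<otimes> z" using b z by (simp add: a_minus_def a_assoc l_neg)
          moreover have "b \<ominus> b \<otimes> z \<in> J" using modI[OF b] J by blast
          moreover have "b \<otimes> z \<in> J" using left_idealD(5) J b True by blast
          ultimately show ?thesis using left_idealD(3) J by metis
        qed
        then show ?thesis using J left_idealD(1) by blast
      qed
    qed
    moreover have "modular_left_ideal M R"
      unfolding modular_left_ideal_def using M(1) modI z by blast
    ultimately have "x \<in> M" using x by (simp add: jacobson_radical_def)
    then have "z \<in> M" using left_idealD(5)[OF M(1)] a by (simp add: z_def)
    then show False using M(3) by simp
  qed
  then obtain b where b: "b \<in> carrier R" and e: "z = b \<ominus> b \<otimes> z" by (auto simp: I_def)
  \<comment> \<open>The quasi-inverse is \<open>- b\<close>.\<close>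
  have "(\<ominus> b) \<oplus> z = (\<ominus> b) \<oplus> (b \<ominus> b \<otimes> z)" using e by simp
  also have "\<dots> = (\<ominus> b) \<otimes> z" using b z by (simp add: minus_mult a_minus_def r_neg1)
  finally show ?thesis using b unfolding z_def by blast
qed

lemma zero_in_jacobson_radical: "\<zero> \<in> jacobson_radical R"
  by (auto simp: jacobson_radical_def maximal_left_ideal_def left_idealD(2))

end

section \<open>Quotients of rings without identity\<close>

locale nonunital_ideal = nonunital_ring +
  fixes I
  assumes I_subgroup: "additive_subgroup I R"
    and I_mult_left: "a \<in> carrier R \<Longrightarrow> x \<in> I \<Longrightarrow> a \<otimes> x \<in> I"
    and I_mult_right: "a \<in> carrier R \<Longrightarrow> x \<in> I \<Longrightarrow> x \<otimes> a \<in> I"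
begin

sublocale abelian_subgroup I R
  using I_subgroup abelian_group_axioms by (rule abelian_subgroupI3)

text \<open>The product of cosets is a union over all pairs of representatives. It is a single coset
  because \<open>(i + x)(j + y)\<close> and \<open>x y\<close> differ by
  \<open>i j + i y + x j\<close>, which lies in the two-sided ideal.\<close>

lemma rcoset_mult_rcos:
  assumes x: "x \<in> carrier R" and y: "y \<in> carrier R"
  shows "[mod I:] (I +> x) \<Otimes> (I +> y) = I +> (x \<otimes> y)"
proof -
  have "I +> (a \<otimes> b) = I +> (x \<otimes> y)" if ab: "a \<in> I +> x" "b \<in> I +> y" for a b
  proof -
    obtain i j where i: "i \<in> I" "a = i \<oplus> x" and j: "j \<in> I" "b = j \<oplus> y"
      using ab by (auto simp: a_r_coset_def')
    have c: "i \<in> carrier R" "j \<in> carrier R" using i j by auto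
    have "a \<otimes> b = (i \<otimes> j \<oplus> i \<otimes> y \<oplus> x \<otimes> j) \<oplus> x \<otimes> y"
      using c x y by (simp add: i(2) j(2) distrib_left distrib_right a_ac)
    moreover have "i \<otimes> j \<oplus> i \<otimes> y \<oplus> x \<otimes> j \<in> I"
      using i j c x y by (intro a_closed I_mult_left I_mult_right)
    ultimately have "a \<otimes> b \<in> I +> (x \<otimes> y)" by (auto simp: a_r_coset_def')
    then show ?thesis using x y by (metis a_repr_independence I_subgroup
        additive_subgroup.a_subgroup mult_closed)
  qed
  moreover have "x \<in> I +> x" "y \<in> I +> y" using x y by (simp_all add: a_rcos_self)
  ultimately show ?thesis unfolding rcoset_mult_def by blast
qed

lemma carrier_Quot: "carrier (R Quot I) = {I +> x | x. x \<in> carrier R}"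
  by (auto simp: FactRing_def A_RCOSETS_def')

lemma Quot_add:
  "x \<in> carrier R \<Longrightarrow> y \<in> carrier R \<Longrightarrow> (I +> x) \<oplus>\<^bsub>R Quot I\<^esub> (I +> y) = I +> (x \<oplus> y)"
  by (simp add: FactRing_def a_rcos_sum)

lemma Quot_mult:
  "x \<in> carrier R \<Longrightarrow> y \<in> carrier R \<Longrightarrow> (I +> x) \<otimes>\<^bsub>R Quot I\<^esub> (I +> y) = I +> (x \<otimes> y)"
  by (simp add: FactRing_def rcoset_mult_rcos)

lemma nonunital_ring_Quot: "nonunital_ring (R Quot I)"
proof (intro nonunital_ring.intro nonunital_ring_axioms.intro)
  show "abelian_group (R Quot I)"
    by (rule comm_group_abelian_groupI)
      (simp add: FactRing_def a_factorgroup_is_comm_group[unfolded A_FactGroup_def'])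
qed (auto simp: carrier_Quot Quot_add Quot_mult mult_assoc distrib_left distrib_right)

end

section \<open>Free algebras and Laurent polynomials\<close>

lemma poly_mapping_induct_single [case_names zero add]:
  assumes "P 0" "\<And>f k v. P f \<Longrightarrow> P (Poly_Mapping.single k v + f)"
  shows "P (f :: 'a \<Rightarrow>\<^sub>0 'b::comm_monoid_add)"
proof (induction f rule: update_induct)
  case const then show ?case by (simp add: assms(1))
next
  case (update f k v)
  have "Poly_Mapping.update k v f = Poly_Mapping.single k v + f"
    using update by (intro poly_mapping_eqI)
      (auto simp: lookup_update lookup_add lookup_single when_def in_keys_iff)
  then show ?case using assms(2) update by simp
qed

lemma poly_mapping_sum_single:
  "a = (\<Sum>w\<in>Poly_Mapping.keys a. Poly_Mapping.single w (Poly_Mapping.lookup a w))"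
  by (rule poly_mapping_eqI)
    (auto simp: lookup_sum lookup_single when_def in_keys_iff sum.delta)

text \<open>The convolution sum collapses to one product when the exponent splits in a single way.
  This covers lowest and highest terms, and multiplication by a monomial.\<close>

lemma lookup_mult_unique:
  fixes f g :: "'a::monoid_add \<Rightarrow>\<^sub>0 'k::semiring_0"
  assumes "\<And>a b. a \<in> Poly_Mapping.keys f \<Longrightarrow> b \<in> Poly_Mapping.keys g \<Longrightarrow> a + b = a0 + b0 \<Longrightarrow> a = a0 \<and> b = b0"
  shows "Poly_Mapping.lookup (f * g) (a0 + b0) = Poly_Mapping.lookup f a0 * Poly_Mapping.lookup g b0"
proof -
  have "Poly_Mapping.lookup (f * g) (a0 + b0) =
    (\<Sum>(a, b). Poly_Mapping.lookup f a * Poly_Mapping.lookup g b when a0 + b0 = a + b)"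
    by (transfer) (simp add: prod_fun_unfold_prod)
  also have "\<dots> = (\<Sum>(a, b). Poly_Mapping.lookup f a * Poly_Mapping.lookup g b when (a0, b0) = (a, b))"
  proof (rule Sum_any.cong, clarify)
    fix a b
    show "(Poly_Mapping.lookup f a * Poly_Mapping.lookup g b when a0 + b0 = a + b) =
      (Poly_Mapping.lookup f a * Poly_Mapping.lookup g b when (a0, b0) = (a, b))"
      using assms[of a b] by (cases "Poly_Mapping.lookup f a = 0"; cases "Poly_Mapping.lookup g b = 0")
        (auto simp: when_def in_keys_iff)
  qed
  also have "\<dots> = (\<Sum>p. (Poly_Mapping.lookup f a0 * Poly_Mapping.lookup g b0) when p = (a0, b0))"
  proof (rule Sum_any.cong, clarify)
    fix a b
    show "(Poly_Mapping.lookup f a * Poly_Mapping.lookup g b when (a0, b0) = (a, b)) =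
      (Poly_Mapping.lookup f a0 * Poly_Mapping.lookup g b0 when (a, b) = (a0, b0))"
      by (auto simp: when_def)
  qed
  finally show ?thesis by simp
qed

text \<open>Compare extreme exponents in \<open>h * u = 1\<close> with \<open>h = 1 - g\<close>. The
  lowest term of \<open>h\<close> sits at 0, so \<open>u\<close> starts at exponent 0; the top
  exponent \<open>M\<close> of \<open>h\<close> is positive, so the product reaches the positive
  exponent \<open>M + hi\<close>.\<close>

lemma Laurent_one_minus_not_unit:
  fixes g u :: "int \<Rightarrow>\<^sub>0 'k::field"
  assumes pos: "\<And>n. n \<in> Poly_Mapping.keys g \<Longrightarrow> n > 0" and g: "g \<noteq> 0"
  shows "(1 - g) * u \<noteq> 1"
proof
  assume 1: "(1 - g) * u = 1"
  define h where "h = 1 - g"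
  have "Poly_Mapping.lookup h 0 = 1"
    using pos[of 0] by (auto simp: h_def lookup_minus in_keys_iff lookup_one)
  then have h0: "0 \<in> Poly_Mapping.keys h" by (simp add: in_keys_iff)
  have hpos: "n \<ge> 0" if "n \<in> Poly_Mapping.keys h" for n
    using that pos[of n] by (force simp: h_def in_keys_iff lookup_minus lookup_one when_def split: if_splits)
  obtain m where "m \<in> Poly_Mapping.keys g"
    using g by (metis keys_eq_empty all_not_in_conv)
  then have m: "m \<in> Poly_Mapping.keys h" "m > 0"
    using pos[of m] by (auto simp: h_def in_keys_iff lookup_minus lookup_one when_def)
  have "u \<noteq> 0" using 1 by auto
  then have uk: "Poly_Mapping.keys u \<noteq> {}" by simp
  define lo where "lo = Min (Poly_Mapping.keys u)"
  define hi where "hi = Max (Poly_Mapping.keys u)"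
  define M where "M = Max (Poly_Mapping.keys h)"
  have lo: "lo \<in> Poly_Mapping.keys u" "\<And>n. n \<in> Poly_Mapping.keys u \<Longrightarrow> lo \<le> n"
    and hi: "hi \<in> Poly_Mapping.keys u" "\<And>n. n \<in> Poly_Mapping.keys u \<Longrightarrow> n \<le> hi"
    using uk by (auto simp: lo_def hi_def)
  have M: "M \<in> Poly_Mapping.keys h" "\<And>n. n \<in> Poly_Mapping.keys h \<Longrightarrow> n \<le> M"
    using h0 by (auto simp: M_def intro!: Max_in)
  have "Poly_Mapping.lookup (h * u) (0 + lo) = Poly_Mapping.lookup h 0 * Poly_Mapping.lookup u lo"
    by (rule lookup_mult_unique) (use lo(2) hpos in force)
  then have "Poly_Mapping.lookup (h * u) lo \<noteq> 0" using h0 lo(1) by (simp add: in_keys_iff)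
  then have "lo = 0" using 1 by (auto simp: h_def lookup_one when_def split: if_splits)
  have "Poly_Mapping.lookup (h * u) (M + hi) = Poly_Mapping.lookup h M * Poly_Mapping.lookup u hi"
    by (rule lookup_mult_unique) (use hi(2) M(2) in force)
  then have "Poly_Mapping.lookup (h * u) (M + hi) \<noteq> 0" using M(1) hi(1) by (simp add: in_keys_iff)
  then have "M + hi = 0" using 1 by (auto simp: h_def lookup_one when_def split: if_splits)
  moreover have "M > 0" using M(2)[OF m(1)] m(2) by simp
  moreover have "hi \<ge> 0" using hi(2)[OF lo(1)] \<open>lo = 0\<close> by simp
  ultimately show False by simp
qed

text \<open>Allows the empty word, so that \<open>1\<close>, scalars and \<open>edge_word []\<close>
  are available as multipliers of the algebra without identity.\<close>

definition unital_free_alg :: "'g set \<Rightarrow> ('g word \<Rightarrow>\<^sub>0 'k::field) set" where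
  "unital_free_alg X = {p. \<forall>w\<in>Poly_Mapping.keys p. set (letters w) \<subseteq> X}"

lemma letters_plus [simp]: "letters (u + w) = letters u @ letters w"
  by (simp add: plus_word_def)

lemma letters_zero [simp]: "letters 0 = []"
  by (simp add: zero_word_def)

lemma unital_free_alg_closed [simp, intro]:
  "0 \<in> unital_free_alg X"
  "1 \<in> unital_free_alg X"
  "scalar c \<in> unital_free_alg X"
  "g \<in> X \<Longrightarrow> gen g \<in> unital_free_alg X"
  "a \<in> unital_free_alg X \<Longrightarrow> b \<in> unital_free_alg X \<Longrightarrow> a + b \<in> unital_free_alg X"
  "a \<in> unital_free_alg X \<Longrightarrow> b \<in> unital_free_alg X \<Longrightarrow> a - b \<in> unital_free_alg X"
  "a \<in> unital_free_alg X \<Longrightarrow> b \<in> unital_free_alg X \<Longrightarrow> a * b \<in> unital_free_alg X"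
  using keys_add[of a b] keys_diff[of a b] keys_mult[of a b]
  by (auto simp: unital_free_alg_def scalar_def gen_def) fastforce+

lemma unital_free_alg_sum:
  "(\<And>i. i \<in> S \<Longrightarrow> f i \<in> unital_free_alg X) \<Longrightarrow> sum f S \<in> unital_free_alg X"
  by (induction S rule: infinite_finite_induct) simp_all

lemma unital_free_alg_power: "a \<in> unital_free_alg X \<Longrightarrow> a ^ k \<in> unital_free_alg X"
  by (induction k) auto

lemma carrier_free_alg_iff:
  "a \<in> carrier (free_alg TYPE('k::field) X) \<longleftrightarrow>
    a \<in> unital_free_alg X \<and> 0 \<notin> Poly_Mapping.keys a"
  by (auto simp: free_alg_def unital_free_alg_def zero_word_def) (metis word.collapse)

lemma zero_word_sum_iff: "(0::'g word) = u + w \<longleftrightarrow> u = 0 \<and> w = 0"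
  by (cases u; cases w) (auto simp: zero_word_def plus_word_def)

lemma free_alg_closed [simp, intro]:
  fixes a b :: "'g word \<Rightarrow>\<^sub>0 'k::field" and X :: "'g set"
  defines "A \<equiv> carrier (free_alg TYPE('k) X)"
  shows "0 \<in> A"
    and "g \<in> X \<Longrightarrow> gen g \<in> A"
    and "a \<in> A \<Longrightarrow> b \<in> A \<Longrightarrow> a + b \<in> A"
    and "a \<in> A \<Longrightarrow> b \<in> A \<Longrightarrow> a - b \<in> A"
    and "a \<in> A \<Longrightarrow> b \<in> unital_free_alg X \<Longrightarrow> a * b \<in> A"
    and "a \<in> unital_free_alg X \<Longrightarrow> b \<in> A \<Longrightarrow> a * b \<in> A"
  unfolding A_def carrier_free_alg_iff
  using keys_add[of a b] keys_diff[of a b] keys_mult[of a b]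
  by (auto simp: zero_word_sum_iff) (auto simp: gen_def zero_word_def)

lemma free_alg_unital:
  "a \<in> carrier (free_alg TYPE('k::field) X) \<Longrightarrow> a \<in> unital_free_alg X"
  by (simp add: carrier_free_alg_iff)

lemma free_alg_sum:
  "(\<And>i. i \<in> S \<Longrightarrow> f i \<in> carrier (free_alg TYPE('k::field) X)) \<Longrightarrow>
    sum f S \<in> carrier (free_alg TYPE('k) X)"
  by (induction S rule: infinite_finite_induct) simp_all

lemma free_alg_simps [simp]:
  "x \<oplus>\<^bsub>free_alg K X\<^esub> y = x + y" "x \<otimes>\<^bsub>free_alg K X\<^esub> y = x * y" "\<zero>\<^bsub>free_alg K X\<^esub> = 0"
  by (simp_all add: free_alg_def)

lemma free_alg_minus: "a \<in> carrier (free_alg TYPE('k::field) X) \<Longrightarrow> - a \<in> carrier (free_alg TYPE('k) X)"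
  using free_alg_closed(4)[OF free_alg_closed(1)] by force

lemma nonunital_ring_free_alg: "nonunital_ring (free_alg TYPE('k::field) X)"
proof (intro nonunital_ring.intro nonunital_ring_axioms.intro abelian_groupI)
  fix x assume x: "x \<in> carrier (free_alg TYPE('k) X)"
  show "\<exists>y\<in>carrier (free_alg TYPE('k) X). y \<oplus>\<^bsub>free_alg TYPE('k) X\<^esub> x = \<zero>\<^bsub>free_alg TYPE('k) X\<^esub>"
    using free_alg_minus[OF x] by (intro bexI[of _ "- x"]) auto
qed (simp_all add: free_alg_unital algebra_simps)

lemma a_inv_free_alg:
  assumes "a \<in> carrier (free_alg TYPE('k::field) X)"
  shows "\<ominus>\<^bsub>free_alg TYPE('k) X\<^esub> a = - a"
proof -
  interpret nonunital_ring "free_alg TYPE('k) X" by (rule nonunital_ring_free_alg)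
  show ?thesis using assms free_alg_minus[OF assms] by (intro minus_equality) auto
qed

lemma scalar_uminus_one [simp]: "scalar (- 1) = - 1"
  by (simp add: scalar_def single_uminus)

lemma scalar_add: "scalar (a + b) = scalar a + scalar b"
  by (simp add: scalar_def single_add)

lemma scalar_zero [simp]: "scalar 0 = 0"
  by (simp add: scalar_def)

lemma alg_ideal_uminus: "x \<in> alg_ideal X R \<Longrightarrow> - x \<in> alg_ideal X R"
  using alg_ideal.scale[of x X R "- 1"] by simp

lemma alg_ideal_diff: "x \<in> alg_ideal X R \<Longrightarrow> y \<in> alg_ideal X R \<Longrightarrow> x - y \<in> alg_ideal X R"
  using alg_ideal.add[OF _ alg_ideal_uminus, of x X R y] by simp

lemma alg_ideal_subset:
  fixes R :: "('g word \<Rightarrow>\<^sub>0 'k::field) set"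
  assumes "R \<subseteq> carrier (free_alg TYPE('k) X)"
  shows "alg_ideal X R \<subseteq> carrier (free_alg TYPE('k) X)"
proof
  fix x assume "x \<in> alg_ideal X R"
  then show "x \<in> carrier (free_alg TYPE('k) X)"
    by induction (use assms in \<open>auto simp: free_alg_unital\<close>)
qed

lemma nonunital_ideal_alg_ideal:
  fixes R :: "('g word \<Rightarrow>\<^sub>0 'k::field) set"
  assumes "R \<subseteq> carrier (free_alg TYPE('k) X)"
  shows "nonunital_ideal (free_alg TYPE('k) X) (alg_ideal X R)"
proof -
  interpret nonunital_ring "free_alg TYPE('k) X" by (rule nonunital_ring_free_alg)
  note sub = alg_ideal_subset[OF assms]
  have "subgroup (alg_ideal X R) (add_monoid (free_alg TYPE('k) X))"
  proof (rule add.subgroupI)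
    show "alg_ideal X R \<noteq> {}" using alg_ideal.zero by blast
    show "\<ominus>\<^bsub>free_alg TYPE('k) X\<^esub> a \<in> alg_ideal X R" if "a \<in> alg_ideal X R" for a
      using that sub by (auto simp: a_inv_free_alg alg_ideal_uminus)
  qed (use sub in \<open>auto intro: alg_ideal.add\<close>)
  then show ?thesis
    by (intro nonunital_ideal.intro nonunital_ideal_axioms.intro nonunital_ring_axioms
        additive_subgroup.intro) (simp_all add: alg_ideal.mult_left alg_ideal.mult_right)
qed

lemma unital_free_alg_decomp:
  assumes "a \<in> unital_free_alg X"
  shows "a - scalar (Poly_Mapping.lookup a 0) \<in> carrier (free_alg TYPE('k::field) X)"
  using assms by (auto simp: carrier_free_alg_iff in_keys_iff lookup_minus) (simp add: scalar_def)

lemma scalar_commute: "scalar c * a = a * scalar c"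
  by (induction a rule: poly_mapping_induct_single)
    (auto simp: scalar_def mult_single algebra_simps)

text \<open>Splitting off the constant term of \<open>a\<close> leaves a combination of nonempty
  words, to which the rule \<open>mult_left\<close> applies; the constant term is covered by
  \<open>scale\<close>.\<close>

lemma alg_ideal_mult_left:
  assumes a: "a \<in> unital_free_alg X" and x: "x \<in> alg_ideal X R"
  shows "a * x \<in> alg_ideal X R"
proof -
  let ?c = "scalar (Poly_Mapping.lookup a 0)"
  have "a * x = (a - ?c) * x + ?c * x" by (simp add: algebra_simps)
  then show ?thesis
    using alg_ideal.add alg_ideal.mult_left[OF unital_free_alg_decomp[OF a] x]
      alg_ideal.scale[OF x] by metis
qed

lemma alg_ideal_mult_right:
  assumes a: "a \<in> unital_free_alg X" and x: "x \<in> alg_ideal X R"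
  shows "x * a \<in> alg_ideal X R"
proof -
  let ?c = "scalar (Poly_Mapping.lookup a 0)"
  have "x * a = x * (a - ?c) + ?c * x" by (simp add: algebra_simps scalar_commute)
  then show ?thesis
    using alg_ideal.add alg_ideal.mult_right[OF unital_free_alg_decomp[OF a] x]
      alg_ideal.scale[OF x] by metis
qed

section \<open>Boundary paths and the action on functions\<close>

abbreviation source :: "('v, 'e) ultragraph \<Rightarrow> 'e + 'v \<Rightarrow> 'v" where
  "source G \<equiv> case_sum (source_of G) id"

text \<open>A finite path is padded by repeating \<open>Inr v\<close> for its last vertex
  \<open>v\<close>, so finite and infinite boundary paths are all streams.
  \<open>source G (shd x)\<close> is the initial vertex in both cases. As ranges are sets,
  consecutive edges are linked by membership.\<close>

coinductive bpath :: "('v, 'e) ultragraph \<Rightarrow> ('e + 'v) stream \<Rightarrow> bool" for G where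
  edge: "e \<in> edges G \<Longrightarrow> source G (shd x) \<in> range_of G e \<Longrightarrow> bpath G x \<Longrightarrow> bpath G (Inl e ## x)"
| stop: "v \<in> verts G \<Longrightarrow> \<not> regular_vertex G v \<Longrightarrow> bpath G (sconst (Inr v))"

lemma bpath_Stream_Inl [simp]:
  "bpath G (Inl e ## x) \<longleftrightarrow> e \<in> edges G \<and> source G (shd x) \<in> range_of G e \<and> bpath G x"
proof
  assume "bpath G (Inl e ## x)"
  then show "e \<in> edges G \<and> source G (shd x) \<in> range_of G e \<and> bpath G x"
    by (cases rule: bpath.cases) (auto dest: arg_cong[where f = shd])
qed (simp add: bpath.edge)

lemma bpath_Inl:
  assumes "bpath G x" "shd x = Inl e"
  shows "x = Inl e ## stl x" "e \<in> edges G" "source G (shd (stl x)) \<in> range_of G e" "bpath G (stl x)"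
proof -
  show x: "x = Inl e ## stl x" by (metis assms(2) stream.collapse)
  show "e \<in> edges G" "source G (shd (stl x)) \<in> range_of G e" "bpath G (stl x)"
    using assms(1) by (subst (asm) x, simp)+
qed

lemma bpath_Inr:
  assumes "bpath G x" "shd x = Inr v"
  shows "x = sconst (Inr v)" "v \<in> verts G" "\<not> regular_vertex G v"
  using assms(1) by (cases rule: bpath.cases; use assms(2) in simp)+

text \<open>A chosen boundary path from each vertex. It stops at the first singular vertex it meets,
  even one that emits edges; the faithfulness proof relies on this, since such a path begins with an
  edge only if \<open>v\<close> is regular.\<close>

primcorec greedy_path :: "('v, 'e) ultragraph \<Rightarrow> 'v \<Rightarrow> ('e + 'v) stream" where
  "shd (greedy_path G v) =
     (if regular_vertex G v then Inl (SOME e. e \<in> edges G \<and> source_of G e = v) else Inr v)"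
| "stl (greedy_path G v) = greedy_path G
     (if regular_vertex G v
      then SOME w. w \<in> range_of G (SOME e. e \<in> edges G \<and> source_of G e = v) else v)"

lemma some_edge:
  assumes "regular_vertex G v"
  shows "(SOME e. e \<in> edges G \<and> source_of G e = v) \<in> edges G"
    "source_of G (SOME e. e \<in> edges G \<and> source_of G e = v) = v"
proof -
  have "\<exists>e. e \<in> edges G \<and> source_of G e = v" using assms by (auto simp: regular_vertex_def)
  from someI_ex[OF this]
  show "(SOME e. e \<in> edges G \<and> source_of G e = v) \<in> edges G"
    "source_of G (SOME e. e \<in> edges G \<and> source_of G e = v) = v" by auto
qed

lemma source_greedy_path [simp]: "source G (shd (greedy_path G v)) = v"
  using some_edge[of G v] by simp

lemma greedy_path_singular:
  assumes "\<not> regular_vertex G v" shows "greedy_path G v = sconst (Inr v)"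
  by (coinduction) (use assms in auto)

lemma (in ultragraph) bpath_greedy_path:
  assumes "v \<in> verts G" shows "bpath G (greedy_path G v)"
proof (rule bpath.coinduct)
  show "\<exists>u\<in>verts G. greedy_path G v = greedy_path G u" using assms by auto
next
  fix x assume "\<exists>u\<in>verts G. x = greedy_path G u"
  then obtain v where v: "v \<in> verts G" and x: "x = greedy_path G v" ..
  show "(\<exists>e y. x = Inl e ## y \<and> e \<in> edges G \<and> source G (shd y) \<in> range_of G e \<and>
          ((\<exists>u\<in>verts G. y = greedy_path G u) \<or> bpath G y)) \<or>
        (\<exists>v. x = sconst (Inr v) \<and> v \<in> verts G \<and> \<not> regular_vertex G v)"
    proof (cases "regular_vertex G v")
      case False
      from greedy_path_singular[OF this] have "x = sconst (Inr v)" unfolding x .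
      then show ?thesis using v False by (intro disjI2 exI[of _ v] conjI)
    next
      case True
      define e where "e = (SOME e. e \<in> edges G \<and> source_of G e = v)"
      define w where "w = (SOME w. w \<in> range_of G e)"
      have e: "e \<in> edges G" unfolding e_def using some_edge[OF True] by blast
      have w: "w \<in> range_of G e" using range_nonempty[OF e] by (simp add: w_def some_in_eq)
      then have wv: "w \<in> verts G" using range_subset_verts[OF e] by blast
      have "x = Inl e ## greedy_path G w"
        unfolding x by (rule stream.expand) (use True in \<open>simp flip: e_def w_def\<close>)
      then show ?thesis
        using e w wv by (intro disjI1 exI[of _ e] exI[of _ "greedy_path G w"] conjI)
          (simp_all only: source_greedy_path, blast)
    qed
qed

declare greedy_path.simps [simp del]

section \<open>The action with Laurent polynomial coefficients\<close>

type_synonym 'k laurent = "int \<Rightarrow>\<^sub>0 'k"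

abbreviation tpow :: "int \<Rightarrow> 'k::field laurent" where
  "tpow n \<equiv> Poly_Mapping.single n 1"

abbreviation lconst :: "'k::field \<Rightarrow> 'k laurent" where
  "lconst \<equiv> Poly_Mapping.single 0"

lemma tpow_mult_left: "tpow m * (tpow n * r) = tpow (m + n) * r"
  by (simp add: mult_single flip: mult.assoc)

lemma keys_tpow_mult: "n \<in> Poly_Mapping.keys (tpow m * f) \<longleftrightarrow> n - m \<in> Poly_Mapping.keys (f :: 'k::field laurent)"
proof -
  have "Poly_Mapping.lookup (tpow m * f) (m + (n - m)) = Poly_Mapping.lookup (tpow m :: 'k laurent) m * Poly_Mapping.lookup f (n - m)"
    by (rule lookup_mult_unique) auto
  then show ?thesis by (simp add: in_keys_iff)
qed

text \<open>\<open>Edge e\<close> prepends \<open>e\<close> to the paths carrying a function and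
  \<open>Ghost e\<close> deletes it, so on functions themselves the shifts run the other way. The
  exponent of \<open>t\<close> is the degree of the word. The \<open>bpath\<close> tests make every
  image vanish off the boundary paths.\<close>

primrec letter_act :: "('v, 'e) ultragraph \<Rightarrow> ('v, 'e) lpa_gen \<Rightarrow>
    (('e + 'v) stream \<Rightarrow> 'k::field laurent) \<Rightarrow> ('e + 'v) stream \<Rightarrow> 'k laurent" where
  "letter_act G (Proj A) \<psi> = (\<lambda>x. if bpath G x \<and> source G (shd x) \<in> A then \<psi> x else 0)"
| "letter_act G (Edge e) \<psi> = (\<lambda>x. if bpath G x \<and> shd x = Inl e then tpow 1 * \<psi> (stl x) else 0)"
| "letter_act G (Ghost e) \<psi> = (\<lambda>x. if bpath G (Inl e ## x) then tpow (- 1) * \<psi> (Inl e ## x) else 0)"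

primrec word_act :: "('v, 'e) ultragraph \<Rightarrow> ('v, 'e) lpa_gen list \<Rightarrow>
    (('e + 'v) stream \<Rightarrow> 'k::field laurent) \<Rightarrow> ('e + 'v) stream \<Rightarrow> 'k laurent" where
  "word_act G [] \<psi> = \<psi>"
| "word_act G (g # w) \<psi> = letter_act G g (word_act G w \<psi>)"

definition act :: "('v, 'e) ultragraph \<Rightarrow> (('v, 'e) lpa_gen word \<Rightarrow>\<^sub>0 'k::field) \<Rightarrow>
    (('e + 'v) stream \<Rightarrow> 'k laurent) \<Rightarrow> ('e + 'v) stream \<Rightarrow> 'k laurent" where
  "act G a \<psi> x = (\<Sum>w\<in>Poly_Mapping.keys a.
     lconst (Poly_Mapping.lookup a w) * word_act G (letters w) \<psi> x)"

definition delta :: "'a \<Rightarrow> 'a \<Rightarrow> 'k::field laurent" where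
  "delta p x = (if x = p then 1 else 0)"

lemma letter_act_add: "letter_act G g (\<lambda>x. \<psi> x + \<phi> x) = (\<lambda>x. letter_act G g \<psi> x + letter_act G g \<phi> x)"
  by (cases g) (auto simp: algebra_simps)

lemma letter_act_scale: "letter_act G g (\<lambda>x. r * \<psi> x) = (\<lambda>x. r * letter_act G g \<psi> x)"
  by (cases g) (auto simp: algebra_simps)

lemma letter_act_zero: "letter_act G g (\<lambda>x. 0) = (\<lambda>x. 0)"
  by (cases g) auto

lemma word_act_add: "word_act G w (\<lambda>x. \<psi> x + \<phi> x) = (\<lambda>x. word_act G w \<psi> x + word_act G w \<phi> x)"
  by (induction w) (simp_all add: letter_act_add)

lemma word_act_scale: "word_act G w (\<lambda>x. r * \<psi> x) = (\<lambda>x. r * word_act G w \<psi> x)"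
  by (induction w) (simp_all add: letter_act_scale)

lemma word_act_append: "word_act G (u @ w) \<psi> = word_act G u (word_act G w \<psi>)"
  by (induction u) simp_all

lemma act_single: "act G (Poly_Mapping.single w c) \<psi> = (\<lambda>x. lconst c * word_act G (letters w) \<psi> x)"
  by (cases "c = 0") (simp_all add: act_def fun_eq_iff)

lemma act_gen [simp]: "act G (gen g) \<psi> = letter_act G g \<psi>"
  by (simp add: gen_def act_single)

lemma act_scalar [simp]: "act G (scalar c) \<psi> = (\<lambda>x. lconst c * \<psi> x)"
  by (simp add: scalar_def act_single)

lemma act_add: "act G (a + b) \<psi> x = act G a \<psi> x + act G b \<psi> x"
  unfolding act_def
  by (rule setsum_keys_plus_distrib) (simp_all add: single_add algebra_simps)

lemma act_zero [simp]: "act G 0 \<psi> = (\<lambda>x. 0)"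
  by (simp add: act_def fun_eq_iff)

lemma act_one [simp]: "act G 1 \<psi> = \<psi>"
  using act_single[of G 0 1 \<psi>] by simp

lemma act_uminus: "act G (- a) \<psi> x = - act G a \<psi> x"
proof -
  have "act G (- a) \<psi> x + act G a \<psi> x = 0" by (simp flip: act_add)
  then show ?thesis by (simp add: eq_neg_iff_add_eq_0)
qed

lemma act_diff: "act G (a - b) \<psi> x = act G a \<psi> x - act G b \<psi> x"
  using act_add[of G a "- b"] by (simp add: act_uminus)

lemma act_sum: "act G (sum f S) \<psi> x = (\<Sum>i\<in>S. act G (f i) \<psi> x)"
  by (induction S rule: infinite_finite_induct) (simp_all add: act_add)

lemma act_add_arg: "act G a (\<lambda>x. \<psi> x + \<phi> x) = (\<lambda>x. act G a \<psi> x + act G a \<phi> x)"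
  by (simp add: fun_eq_iff act_def word_act_add algebra_simps sum.distrib)

lemma act_scale_arg: "act G a (\<lambda>x. r * \<psi> x) = (\<lambda>x. r * act G a \<psi> x)"
  by (simp add: fun_eq_iff act_def word_act_scale sum_distrib_left algebra_simps)

lemma act_zero_arg [simp]: "act G a (\<lambda>x. 0) = (\<lambda>x. 0)"
  using act_scale_arg[of G a 0] by simp

lemma act_mult: "act G (a * b) \<psi> = act G a (act G b \<psi>)"
proof (induction a rule: poly_mapping_induct_single)
  case zero
  then show ?case by (simp add: fun_eq_iff)
next
  case (add a u c)
  have "act G (Poly_Mapping.single u c * b) \<psi> = act G (Poly_Mapping.single u c) (act G b \<psi>)"
  proof (induction b rule: poly_mapping_induct_single)
    case zero
    then show ?case using act_zero_arg by (simp add: fun_eq_iff act_zero)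
  next
    case (add b w d)
    have "act G b' \<psi> = (\<lambda>x. act G (Poly_Mapping.single w d) \<psi> x + act G b \<psi> x)"
      if "b' = Poly_Mapping.single w d + b" for b'
      using that by (simp add: act_add fun_eq_iff)
    then show ?case
      using add by (simp add: act_add_arg distrib_left act_add fun_eq_iff)
        (simp add: act_single mult_single word_act_append word_act_scale flip: mult.assoc)
  qed
  then show ?case using add by (simp add: act_add distrib_right fun_eq_iff)
qed

context ultragraph
begin

lemma gen_verts_subset: "A \<in> gen_verts G \<Longrightarrow> A \<subseteq> verts G"
  by (induction rule: gen_verts.induct) (use range_subset_verts in auto)

lemmas gen_verts_closed [simp] = gen_verts.intros

lemma source_gen_verts [simp]: "e \<in> edges G \<Longrightarrow> {source_of G e} \<in> gen_verts G"
  by (simp add: gen_verts.singleton source_in_verts)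

lemma Proj_gens [simp]: "Proj A \<in> lpa_gens G \<longleftrightarrow> A \<in> gen_verts G"
  and Edge_gens [simp]: "Edge e \<in> lpa_gens G \<longleftrightarrow> e \<in> edges G"
  and Ghost_gens [simp]: "Ghost e \<in> lpa_gens G \<longleftrightarrow> e \<in> edges G"
  by (auto simp: lpa_gens_def)

lemma lpa_relations_subset:
  "(lpa_relations G :: (_ \<Rightarrow>\<^sub>0 'k::field) set) \<subseteq> carrier (free_alg TYPE('k) (lpa_gens G))"
proof
  fix a :: "_ \<Rightarrow>\<^sub>0 'k" assume "a \<in> lpa_relations G"
  then show "a \<in> carrier (free_alg TYPE('k) (lpa_gens G))"
  proof cases
    case (regular v)
    then have "{v} \<in> gen_verts G" by (auto simp: regular_vertex_def intro: gen_verts.singleton)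
    then show ?thesis unfolding regular
      by (intro free_alg_closed free_alg_sum free_alg_unital) auto
  qed auto
qed

text \<open>For relation (4): a boundary path from a regular vertex cannot have stopped, so it
  begins with exactly one of the edges at that vertex, and exactly one summand
  \<open>ed e * gh e\<close> reproduces the function there.\<close>

lemma act_lpa_relations:
  assumes "a \<in> lpa_relations G" shows "act G a \<psi> x = (0 :: 'k::field laurent)"
  using assms
proof cases
  case (regular v)
  let ?S = "{e \<in> edges G. source_of G e = v}"
  have fin: "finite ?S" using regular(2) by (simp add: regular_vertex_def)
  have "act G (ed e * gh e) \<psi> x = (if bpath G x \<and> shd x = Inl e then \<psi> x else 0)" for e
  proof (cases "bpath G x \<and> shd x = Inl e")
    case True
    then have x: "bpath G x" "shd x = Inl e" by auto
    show ?thesis using x bpath_Inl[OF x]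
      by (simp add: act_mult tpow_mult_left del: bpath_Stream_Inl flip: bpath_Inl(1)[OF x])
  qed (auto simp: act_mult)
  then have *: "act G (\<Sum>e\<in>?S. ed e * gh e) \<psi> x = (\<Sum>e\<in>?S. if bpath G x \<and> shd x = Inl e then \<psi> x else 0)"
    by (simp add: act_sum)
  also have "\<dots> = (if bpath G x \<and> source G (shd x) = v then \<psi> x else 0)"
  proof (cases "bpath G x")
    case True
    show ?thesis
    proof (cases "shd x")
      case (Inl e)
      then show ?thesis using True bpath_Inl(2)[OF True Inl] fin by (simp add: sum.delta)
    next
      case (Inr w)
      then show ?thesis using True bpath_Inr(3)[OF True Inr] regular(2) by auto
    qed
  qed simp
  finally show ?thesis using regular(1) by (simp add: act_diff)
next
  case (ghost_edge e f)
  then show ?thesis by (auto simp: act_mult act_diff tpow_mult_left)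
qed (auto simp: act_mult act_diff act_add dest: bpath_Inl(2-4))

lemma act_alg_ideal:
  assumes "a \<in> alg_ideal (lpa_gens G) (lpa_relations G)"
  shows "act G a \<psi> = (\<lambda>x. 0 :: 'k::field laurent)"
  using assms
proof (induction arbitrary: \<psi>)
  case (base a) then show ?case using act_lpa_relations by blast
qed (simp_all add: fun_eq_iff[of "act G (_ + _) \<psi>" for \<psi>] act_add act_mult)

end

section \<open>Computing modulo the relations\<close>

primrec edge_word :: "'e list \<Rightarrow> ('v, 'e) lpa_gen word \<Rightarrow>\<^sub>0 'k::field" where
  "edge_word [] = 1"
| "edge_word (e # \<alpha>) = ed e * edge_word \<alpha>"

lemma edge_word_append: "edge_word (\<alpha> @ \<beta>) = edge_word \<alpha> * edge_word \<beta>"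
  by (induction \<alpha>) (simp_all add: mult.assoc)

abbreviation prepend :: "'e list \<Rightarrow> ('e + 'v) stream \<Rightarrow> ('e + 'v) stream" where
  "prepend \<alpha> p \<equiv> map Inl \<alpha> @- p"

text \<open>The junction of \<open>\<alpha>\<close> with the rest tests only the initial vertex of
  the rest. Hence conditions stated for one path from a vertex, such as \<open>greedy_path\<close>,
  hold for every boundary path from it.\<close>

lemma bpath_prepend_change:
  assumes "bpath G (prepend \<alpha> p)" "source G (shd p) = source G (shd q)" "bpath G q"
  shows "bpath G (prepend \<alpha> q)"
  using assms(1)
proof (induction \<alpha>)
  case (Cons e \<alpha>)
  moreover have "source G (shd (prepend \<alpha> p)) = source G (shd (prepend \<alpha> q))"
    using assms(2) by (cases \<alpha>) auto
  ultimately show ?case by auto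
qed (use assms(3) in simp)

lemma bpath_prependD: "bpath G (prepend \<alpha> p) \<Longrightarrow> bpath G p"
  by (induction \<alpha>) auto

lemma letter_act_Proj_delta:
  "bpath G p \<Longrightarrow> letter_act G (Proj A) (delta p) = (\<lambda>x. if source G (shd p) \<in> A then delta p x else 0)"
  by (auto simp: delta_def)

lemma act_pr_delta:
  assumes "bpath G p" "source G (shd p) \<in> B"
  shows "act G (pr B) (delta p) = delta p"
  using assms letter_act_Proj_delta[of G p B] by (simp del: letter_act.simps)

lemma letter_act_Edge_delta:
  "letter_act G (Edge e) (delta p) =
    (\<lambda>x. if bpath G (Inl e ## p) then tpow 1 * delta (Inl e ## p) x else 0)"
proof (rule ext)
  fix x
  have "bpath G x \<and> shd x = Inl e \<and> stl x = p \<longleftrightarrow> bpath G (Inl e ## p) \<and> x = Inl e ## p"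
    by (metis stream.collapse stream.sel)
  then show "letter_act G (Edge e) (delta p) x =
    (if bpath G (Inl e ## p) then tpow 1 * delta (Inl e ## p) x else 0)"
    by (auto simp: delta_def)
qed

lemma letter_act_Ghost_delta:
  assumes "bpath G p"
  shows "letter_act G (Ghost e) (delta p) =
    (\<lambda>x. if shd p = Inl e then tpow (- 1) * delta (stl p) x else 0)"
proof (rule ext)
  fix x
  have "bpath G (Inl e ## x) \<and> Inl e ## x = p \<longleftrightarrow> shd p = Inl e \<and> x = stl p"
    using assms by (metis stream.collapse stream.sel)
  then show "letter_act G (Ghost e) (delta p) x =
    (if shd p = Inl e then tpow (- 1) * delta (stl p) x else 0)"
    by (auto simp: delta_def)
qed

lemma act_edge_word_delta:
  assumes "bpath G (prepend \<alpha> p)"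
  shows "act G (edge_word \<alpha>) (delta p) = (\<lambda>x. tpow (int (length \<alpha>)) * delta (prepend \<alpha> p) x)"
  using assms
proof (induction \<alpha>)
  case (Cons e \<alpha>)
  then have "bpath G (prepend \<alpha> p)" by simp
  from Cons.IH[OF this] show ?case
    using Cons.prems by (simp add: act_mult letter_act_scale letter_act_Edge_delta tpow_mult_left
        add.commute del: letter_act.simps)
qed simp

locale leavitt = ultragraph G for G :: "('v, 'e) ultragraph" +
  fixes K :: "'k::field itself"
begin

abbreviation I :: "(('v, 'e) lpa_gen word \<Rightarrow>\<^sub>0 'k) set" where
  "I \<equiv> alg_ideal (lpa_gens G) (lpa_relations G)"

abbreviation U :: "(('v, 'e) lpa_gen word \<Rightarrow>\<^sub>0 'k) set" where
  "U \<equiv> unital_free_alg (lpa_gens G)"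

text \<open>Congruence modulo the relations, defined also for elements with a constant term.\<close>

definition eqv :: "(('v, 'e) lpa_gen word \<Rightarrow>\<^sub>0 'k) \<Rightarrow> (('v, 'e) lpa_gen word \<Rightarrow>\<^sub>0 'k) \<Rightarrow> bool"
    (infix "\<approx>" 50) where
  "a \<approx> b \<longleftrightarrow> a - b \<in> I"

lemma I_subset: "a \<in> I \<Longrightarrow> a \<in> carrier (free_alg TYPE('k) (lpa_gens G))"
  using alg_ideal_subset[OF lpa_relations_subset] by blast

lemma eqv_refl [simp]: "a \<approx> a"
  by (simp add: eqv_def alg_ideal.zero)

lemma eqv_sym: "a \<approx> b \<Longrightarrow> b \<approx> a"
  using alg_ideal_uminus[of "a - b"] by (simp add: eqv_def)

lemma eqv_trans [trans]: "a \<approx> b \<Longrightarrow> b \<approx> c \<Longrightarrow> a \<approx> c"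
  using alg_ideal.add[of "a - b" _ _ "b - c"] by (simp add: eqv_def)

lemma eqv_add: "a \<approx> a' \<Longrightarrow> b \<approx> b' \<Longrightarrow> a + b \<approx> a' + b'"
  using alg_ideal.add[of "a - a'" _ _ "b - b'"] by (simp add: eqv_def algebra_simps)

lemma eqv_diff: "a \<approx> a' \<Longrightarrow> b \<approx> b' \<Longrightarrow> a - b \<approx> a' - b'"
  using alg_ideal_diff[of "a - a'" _ _ "b - b'"] by (simp add: eqv_def algebra_simps)

lemma eqv_left: "a \<approx> b \<Longrightarrow> x \<in> U \<Longrightarrow> x * a \<approx> x * b"
  using alg_ideal_mult_left[of x _ "a - b"] by (simp add: eqv_def algebra_simps)

lemma eqv_right: "a \<approx> b \<Longrightarrow> x \<in> U \<Longrightarrow> a * x \<approx> b * x"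
  using alg_ideal_mult_right[of x _ "a - b"] by (simp add: eqv_def algebra_simps)

lemma eqv_sum: "(\<And>i. i \<in> S \<Longrightarrow> f i \<approx> g i) \<Longrightarrow> sum f S \<approx> sum g S"
  by (induction S rule: infinite_finite_induct) (auto intro: eqv_add)

lemma eqv_zero_iff: "a \<approx> 0 \<longleftrightarrow> a \<in> I"
  by (simp add: eqv_def)

lemma eqv_U: "a \<approx> b \<Longrightarrow> b \<in> U \<Longrightarrow> a \<in> U"
  using I_subset[of "a - b"] free_alg_unital unital_free_alg_closed(5)[of "a - b" _ b]
  by (auto simp: eqv_def)

lemma eqv_act: "a \<approx> b \<Longrightarrow> act G a \<psi> = act G b \<psi>"
  using act_alg_ideal[of "a - b" \<psi>] by (auto simp: eqv_def act_diff fun_eq_iff)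

lemma rel_eqv: "a - b \<in> lpa_relations G \<Longrightarrow> a \<approx> b"
  unfolding eqv_def by (rule alg_ideal.base)

lemmas pr_pr = rel_eqv[OF lpa_relations.proj_inter]
  and source_ed = rel_eqv[OF lpa_relations.source_edge]
  and ed_range = rel_eqv[OF lpa_relations.edge_range]
  and range_gh = rel_eqv[OF lpa_relations.range_ghost]
  and gh_source = rel_eqv[OF lpa_relations.ghost_source]
  and gh_ed = rel_eqv[OF lpa_relations.ghost_edge]
  and pr_regular = rel_eqv[OF lpa_relations.regular]

lemma pr_empty: "pr {} \<approx> 0"
  using alg_ideal.base[OF lpa_relations.proj_empty] by (simp add: eqv_zero_iff)

lemma edge_word_U [simp]: "set \<alpha> \<subseteq> edges G \<Longrightarrow> edge_word \<alpha> \<in> U"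
  by (induction \<alpha>) auto

lemma pr_U [simp]: "A \<in> gen_verts G \<Longrightarrow> pr A \<in> U"
  and ed_U [simp]: "e \<in> edges G \<Longrightarrow> ed e \<in> U"
  and gh_U [simp]: "e \<in> edges G \<Longrightarrow> gh e \<in> U"
  by auto

lemma pr_pr_right:
  "A \<in> gen_verts G \<Longrightarrow> B \<in> gen_verts G \<Longrightarrow> x \<in> U \<Longrightarrow> x * pr A * pr B \<approx> x * pr (A \<inter> B)"
  using eqv_left[OF pr_pr] by (simp add: mult.assoc)

lemma eqv_zero_right: "a \<approx> 0 \<Longrightarrow> x \<in> U \<Longrightarrow> a * x \<approx> 0"
  using eqv_right[of a 0 x] by simp

lemma eqv_zero_left: "a \<approx> 0 \<Longrightarrow> x \<in> U \<Longrightarrow> x * a \<approx> 0"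
  using eqv_left[of a 0 x] by simp

lemma pr_empty_right: "x \<in> U \<Longrightarrow> x * pr {} \<approx> 0"
  using eqv_zero_left[OF pr_empty] .

lemma pr_disjoint_union:
  assumes "A \<in> gen_verts G" "B \<in> gen_verts G" "A \<inter> B = {}"
  shows "pr (A \<union> B) \<approx> pr A + pr B"
proof -
  have "pr (A \<union> B) \<approx> pr A + pr B - pr (A \<inter> B)"
    using assms by (intro rel_eqv lpa_relations.proj_union)
  also have "\<dots> \<approx> pr A + pr B - 0"
    using assms(3) pr_empty by (intro eqv_diff) auto
  finally show ?thesis by simp
qed

text \<open>Relation (2) inserts \<open>pr {source_of G e}\<close>, and the product of the two
  projections is that of a singleton or of the empty set.\<close>

lemma pr_ed:
  assumes "A \<in> gen_verts G" "e \<in> edges G"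
  shows "pr A * ed e \<approx> (if source_of G e \<in> A then ed e else 0)"
proof -
  have "pr A * ed e \<approx> pr A * (pr {source_of G e} * ed e)"
    using assms by (intro eqv_left eqv_sym[OF source_ed]) auto
  also have "\<dots> = pr A * pr {source_of G e} * ed e" by (simp add: mult.assoc)
  also have "\<dots> \<approx> pr (A \<inter> {source_of G e}) * ed e"
    using assms by (intro eqv_right pr_pr) auto
  also have "\<dots> \<approx> (if source_of G e \<in> A then ed e else 0)"
    using assms source_ed eqv_zero_right[OF pr_empty] by (auto simp: Int_insert_right)
  finally show ?thesis .
qed

lemma gh_pr:
  assumes "A \<in> gen_verts G" "e \<in> edges G"
  shows "gh e * pr A \<approx> (if source_of G e \<in> A then gh e else 0)"
proof -
  have "gh e * pr A \<approx> (gh e * pr {source_of G e}) * pr A"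
    using assms by (intro eqv_right eqv_sym[OF gh_source]) auto
  also have "\<dots> \<approx> gh e * pr ({source_of G e} \<inter> A)"
    using assms by (intro pr_pr_right) auto
  also have "\<dots> \<approx> (if source_of G e \<in> A then gh e else 0)"
    using assms gh_source pr_empty_right by (auto simp: Int_insert_left)
  finally show ?thesis .
qed

section \<open>Elements without ghost edges\<close>

text \<open>
  The last condition of the second rule says only that the path \<open>\<alpha>\<close> can be continued at every
  vertex of \<open>A\<close>; the choice of the boundary path from \<open>v\<close> does not matter.
\<close>

inductive ghost_free :: "(('v, 'e) lpa_gen word \<Rightarrow>\<^sub>0 'k) \<Rightarrow> bool" where
  zero: "ghost_free 0"
| add: "ghost_free x \<Longrightarrow> A \<in> gen_verts G \<Longrightarrow> set \<alpha> \<subseteq> edges G \<Longrightarrow>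
    (\<And>v. v \<in> A \<Longrightarrow> bpath G (prepend \<alpha> (greedy_path G v))) \<Longrightarrow>
    ghost_free (scalar c * edge_word \<alpha> * pr A + x)"
| eqv: "ghost_free x \<Longrightarrow> y \<approx> x \<Longrightarrow> ghost_free y"

lemma ghost_free_U: "ghost_free x \<Longrightarrow> x \<in> U"
  by (induction rule: ghost_free.induct) (auto intro: eqv_U)

lemma ghost_free_term:
  "A \<in> gen_verts G \<Longrightarrow> set \<alpha> \<subseteq> edges G \<Longrightarrow>
    (\<And>v. v \<in> A \<Longrightarrow> bpath G (prepend \<alpha> (greedy_path G v))) \<Longrightarrow>
    ghost_free (scalar c * edge_word \<alpha> * pr A)"
  using ghost_free.add[OF ghost_free.zero] by simp

lemma ghost_free_plus: "ghost_free x \<Longrightarrow> ghost_free y \<Longrightarrow> ghost_free (x + y)"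
proof (induction rule: ghost_free.induct)
  case (add x A \<alpha> c)
  then show ?case by (simp add: add.assoc ghost_free.add)
next
  case (eqv x z)
  then show ?case by (blast intro: ghost_free.eqv eqv_add eqv_refl)
qed simp

lemma ghost_free_pr: "ghost_free x \<Longrightarrow> C \<in> gen_verts G \<Longrightarrow> ghost_free (x * pr C)"
proof (induction rule: ghost_free.induct)
  case (add x A \<alpha> c)
  have "ghost_free (scalar c * edge_word \<alpha> * pr (A \<inter> C) + x * pr C)"
    using add by (intro ghost_free.add) auto
  moreover have "(scalar c * edge_word \<alpha> * pr A + x) * pr C \<approx> scalar c * edge_word \<alpha> * pr (A \<inter> C) + x * pr C"
    unfolding distrib_right using add by (intro eqv_add pr_pr_right eqv_refl) auto
  ultimately show ?case by (rule ghost_free.eqv)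
next
  case (eqv x y)
  then show ?case by (blast intro: ghost_free.eqv eqv_right pr_U)
qed (simp add: ghost_free.zero)

text \<open>A term \<open>edge_word \<alpha> * pr A\<close> times \<open>ed f\<close> is 0 unless
  \<open>f\<close> starts in \<open>A\<close>; then it is the term for the longer path
  \<open>\<alpha> @ [f]\<close> with projection onto the range of \<open>f\<close>.\<close>

lemma ghost_free_ed: "ghost_free x \<Longrightarrow> f \<in> edges G \<Longrightarrow> ghost_free (x * ed f)"
proof (induction rule: ghost_free.induct)
  case (add x A \<alpha> c)
  let ?y = "scalar c * edge_word \<alpha>"
  have U: "?y \<in> U" using add by auto
  have "?y * pr A * ed f \<approx> (if source_of G f \<in> A then scalar c * edge_word (\<alpha> @ [f]) * pr (range_of G f) else 0)"
  proof -
    have "?y * (pr A * ed f) \<approx> ?y * (if source_of G f \<in> A then ed f else 0)"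
      using add U by (intro eqv_left pr_ed) auto
    also have "\<dots> \<approx> ?y * (if source_of G f \<in> A then ed f * pr (range_of G f) else 0)"
      using add U by (intro eqv_left) (auto intro: eqv_sym[OF ed_range])
    finally show ?thesis by (auto simp: edge_word_append mult.assoc)
  qed
  then have e: "(?y * pr A + x) * ed f \<approx>
     (if source_of G f \<in> A then scalar c * edge_word (\<alpha> @ [f]) * pr (range_of G f) else 0) + x * ed f"
    unfolding distrib_right by (intro eqv_add eqv_refl)
  \<comment> \<open>The path consisting of \<open>f\<close> and the greedy path from
    \<open>v\<close> starts at the source of \<open>f\<close>, a vertex of \<open>A\<close>, so it
    may replace the greedy path from there.\<close>
  have "bpath G (prepend (\<alpha> @ [f]) (greedy_path G v))" if "source_of G f \<in> A" "v \<in> range_of G f" for v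
  proof -
    have "bpath G (greedy_path G v)"
      using that add.prems range_subset_verts bpath_greedy_path by blast
    then have "bpath G (Inl f ## greedy_path G v)" using that add.prems by simp
    from bpath_prepend_change[OF add.hyps(4)[OF that(1)] _ this]
    show ?thesis by simp
  qed
  then have "ghost_free ((if source_of G f \<in> A then scalar c * edge_word (\<alpha> @ [f]) * pr (range_of G f) else 0) + x * ed f)"
    using add by (auto intro!: ghost_free.add)
  then show ?case using e by (rule ghost_free.eqv)
next
  case (eqv x y)
  then show ?case by (blast intro: ghost_free.eqv eqv_right ed_U)
qed (simp add: ghost_free.zero)

text \<open>A local right identity: the union of the finitely many sets \<open>A\<close> in the
  terms of \<open>x\<close>.\<close>

lemma ghost_free_support: "ghost_free x \<Longrightarrow> \<exists>B\<in>gen_verts G. x * pr B \<approx> x"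
proof (induction rule: ghost_free.induct)
  case (add x A \<alpha> c)
  then obtain B where B: "B \<in> gen_verts G" "x * pr B \<approx> x" by blast
  let ?y = "scalar c * edge_word \<alpha>" and ?C = "A \<union> B"
  have U: "?y \<in> U" "x \<in> U" using add by (auto intro: ghost_free_U)
  have "?y * pr A * pr ?C \<approx> ?y * pr (A \<inter> ?C)"
    using add B U by (intro pr_pr_right) auto
  moreover have "x * pr ?C \<approx> x"
  proof -
    have "x * pr ?C \<approx> x * pr B * pr ?C"
      using add B by (intro eqv_right eqv_sym[OF B(2)]) auto
    also have "\<dots> \<approx> x * pr (B \<inter> ?C)"
      using add B U by (intro pr_pr_right) auto
    also have "\<dots> = x * pr B" by (simp add: Int_absorb2)
    also have "\<dots> \<approx> x" by fact
    finally show ?thesis .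
  qed
  ultimately have "(?y * pr A + x) * pr ?C \<approx> ?y * pr A + x"
    unfolding distrib_right by (intro eqv_add) (simp_all add: Int_absorb2)
  then show ?case using add B by (intro bexI[of _ ?C]) auto
next
  case (eqv x y)
  then obtain B where B: "B \<in> gen_verts G" "x * pr B \<approx> x" by blast
  have "y * pr B \<approx> x * pr B" using eqv B by (intro eqv_right) auto
  also have "\<dots> \<approx> x" by fact
  also have "\<dots> \<approx> y" using eqv eqv_sym by blast
  finally show ?case using B by blast
qed (auto intro: gen_verts.empty)

section \<open>Faithfulness of the action\<close>

text \<open>All terms share the projection \<open>pr B\<close> and have distinct edge words, each of
  which can be continued from every vertex of \<open>B\<close>. So the coefficients are the same at
  all vertices of \<open>B\<close>, and one test path from \<open>B\<close> detects them.\<close>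

definition uniform :: "'v set \<Rightarrow> (('v, 'e) lpa_gen word \<Rightarrow>\<^sub>0 'k) \<Rightarrow> bool" where
  "uniform B y \<longleftrightarrow> (\<exists>\<Phi> k. finite \<Phi> \<and>
     (\<forall>\<alpha>\<in>\<Phi>. set \<alpha> \<subseteq> edges G \<and> (\<forall>v\<in>B. bpath G (prepend \<alpha> (greedy_path G v)))) \<and>
     y \<approx> (\<Sum>\<alpha>\<in>\<Phi>. scalar (k \<alpha>) * edge_word \<alpha> * pr B))"

lemma uniform_zero: "uniform B 0"
  unfolding uniform_def by (intro exI[of _ "{}"]) auto

lemma uniform_restrict:
  assumes "uniform B y" "B \<in> gen_verts G" "C \<in> gen_verts G" "C \<subseteq> B"
  shows "uniform C (y * pr C)"
proof -
  obtain \<Phi> k where \<Phi>: "finite \<Phi>"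
    "\<And>\<alpha>. \<alpha> \<in> \<Phi> \<Longrightarrow> set \<alpha> \<subseteq> edges G \<and> (\<forall>v\<in>B. bpath G (prepend \<alpha> (greedy_path G v)))"
    and y: "y \<approx> (\<Sum>\<alpha>\<in>\<Phi>. scalar (k \<alpha>) * edge_word \<alpha> * pr B)"
    using assms(1) unfolding uniform_def by blast
  have "y * pr C \<approx> (\<Sum>\<alpha>\<in>\<Phi>. scalar (k \<alpha>) * edge_word \<alpha> * pr B) * pr C"
    using assms by (intro eqv_right[OF y]) auto
  also have "\<dots> = (\<Sum>\<alpha>\<in>\<Phi>. scalar (k \<alpha>) * edge_word \<alpha> * pr B * pr C)"
    by (simp add: sum_distrib_right)
  also have "\<dots> \<approx> (\<Sum>\<alpha>\<in>\<Phi>. scalar (k \<alpha>) * edge_word \<alpha> * pr (B \<inter> C))"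
    using assms \<Phi> by (intro eqv_sum pr_pr_right) auto
  also have "B \<inter> C = C" using assms by auto
  finally show ?thesis unfolding uniform_def using \<Phi> assms(4) by blast
qed

lemma uniform_plus_term:
  assumes "uniform B y" "set \<alpha> \<subseteq> edges G" "\<And>v. v \<in> B \<Longrightarrow> bpath G (prepend \<alpha> (greedy_path G v))"
  shows "uniform B (y + scalar c * edge_word \<alpha> * pr B)"
proof -
  obtain \<Phi> k where \<Phi>: "finite \<Phi>"
    "\<And>\<alpha>. \<alpha> \<in> \<Phi> \<Longrightarrow> set \<alpha> \<subseteq> edges G \<and> (\<forall>v\<in>B. bpath G (prepend \<alpha> (greedy_path G v)))"
    and y: "y \<approx> (\<Sum>\<alpha>\<in>\<Phi>. scalar (k \<alpha>) * edge_word \<alpha> * pr B)"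
    using assms(1) unfolding uniform_def by blast
  \<comment> \<open>The path \<open>\<alpha>\<close> may already occur in \<open>\<Phi>\<close>;
    then its coefficient grows by \<open>c\<close>.\<close>
  define k' where "k' \<beta> = (if \<beta> \<in> \<Phi> then k \<beta> else 0) + (if \<beta> = \<alpha> then c else 0)" for \<beta>
  let ?m = "\<lambda>\<beta>. edge_word \<beta> * pr B"
  have "(\<Sum>\<beta>\<in>insert \<alpha> \<Phi>. scalar (k' \<beta>) * ?m \<beta>) =
    (\<Sum>\<beta>\<in>insert \<alpha> \<Phi>. if \<beta> \<in> \<Phi> then scalar (k \<beta>) * ?m \<beta> else 0) +
    (\<Sum>\<beta>\<in>insert \<alpha> \<Phi>. if \<beta> = \<alpha> then scalar c * ?m \<beta> else 0)"
    unfolding sum.distrib[symmetric] by (intro sum.cong) (auto simp: k'_def scalar_add distrib_right)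
  also have "(\<Sum>\<beta>\<in>insert \<alpha> \<Phi>. if \<beta> \<in> \<Phi> then scalar (k \<beta>) * ?m \<beta> else 0) = (\<Sum>\<beta>\<in>\<Phi>. scalar (k \<beta>) * ?m \<beta>)"
    using \<Phi>(1) by (intro sum.mono_neutral_cong_right) auto
  also have "(\<Sum>\<beta>\<in>insert \<alpha> \<Phi>. if \<beta> = \<alpha> then scalar c * ?m \<beta> else 0) = scalar c * ?m \<alpha>"
    using \<Phi>(1) by (subst sum.delta) auto
  finally have "y + scalar c * edge_word \<alpha> * pr B \<approx> (\<Sum>\<beta>\<in>insert \<alpha> \<Phi>. scalar (k' \<beta>) * edge_word \<beta> * pr B)"
    using eqv_add[OF y eqv_refl] by (simp add: mult.assoc)
  then show ?thesis
    unfolding uniform_def using \<Phi> assms by (intro exI[of _ "insert \<alpha> \<Phi>"] exI[of _ k']) auto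
qed

lemma act_term_delta:
  assumes "bpath G (prepend \<alpha> p)" "source G (shd p) \<in> B"
  shows "act G (scalar c * edge_word \<alpha> * pr B) (delta p) =
    (\<lambda>x. if x = prepend \<alpha> p then Poly_Mapping.single (int (length \<alpha>)) c else 0)"
  using assms bpath_prependD[OF assms(1)]
  by (auto simp: act_mult act_pr_delta act_edge_word_delta delta_def mult_single fun_eq_iff
      simp del: act_gen)

text \<open>Here the variable \<open>t\<close> separates paths. Different \<open>\<alpha>\<close>,
  \<open>\<beta>\<close> may give the same boundary path in front of a periodic \<open>p\<close>,
  but only if their lengths differ, and then they contribute to different exponents. So
  \<open>k \<alpha>\<close> is the coefficient of exponent \<open>length \<alpha>\<close> at
  \<open>prepend \<alpha> p\<close>.\<close>

lemma uniform_vanish: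
  assumes "uniform B y" "B \<in> gen_verts G" "\<And>v. v \<in> B \<Longrightarrow> act G y (delta (greedy_path G v)) = (\<lambda>x. 0)"
  shows "y \<approx> 0"
proof -
  obtain \<Phi> k where \<Phi>: "finite \<Phi>"
    "\<And>\<alpha>. \<alpha> \<in> \<Phi> \<Longrightarrow> set \<alpha> \<subseteq> edges G \<and> (\<forall>v\<in>B. bpath G (prepend \<alpha> (greedy_path G v)))"
    and y: "y \<approx> (\<Sum>\<alpha>\<in>\<Phi>. scalar (k \<alpha>) * edge_word \<alpha> * pr B)" (is "_ \<approx> ?s")
    using assms(1) unfolding uniform_def by blast
  have "?s \<approx> 0"
  \<comment> \<open>An empty \<open>B\<close> provides no test path, but then every term ends in
    \<open>pr {}\<close>.\<close>
  proof (cases "B = {}")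
    case True
    have "?s \<approx> (\<Sum>\<alpha>\<in>\<Phi>. 0)"
      unfolding True using \<Phi> by (intro eqv_sum pr_empty_right) auto
    then show ?thesis by simp
  next
    case False
    then obtain v where v: "v \<in> B" by blast
    let ?p = "greedy_path G v"
    have "k \<alpha> = 0" if \<alpha>: "\<alpha> \<in> \<Phi>" for \<alpha>
    proof -
      have "0 = act G ?s (delta ?p) (prepend \<alpha> ?p)"
        using assms(3)[OF v] eqv_act[OF y] by simp
      also have "\<dots> = (\<Sum>\<beta>\<in>\<Phi>. if prepend \<alpha> ?p = prepend \<beta> ?p then Poly_Mapping.single (int (length \<beta>)) (k \<beta>) else 0)"
        unfolding act_sum using \<Phi>(2) v by (intro sum.cong) (auto simp: act_term_delta)
      finally have "0 = Poly_Mapping.lookup (\<Sum>\<beta>\<in>\<Phi>. if prepend \<alpha> ?p = prepend \<beta> ?p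
          then Poly_Mapping.single (int (length \<beta>)) (k \<beta>) else 0) (int (length \<alpha>))" by simp
      also have "\<dots> = (\<Sum>\<beta>\<in>\<Phi>. if \<beta> = \<alpha> then k \<beta> else 0)"
        unfolding lookup_sum
      proof (rule sum.cong[OF refl])
        fix \<beta>
        have "\<beta> = \<alpha>" if "prepend \<alpha> ?p = prepend \<beta> ?p" "length \<beta> = length \<alpha>"
        proof -
          have "map Inl \<alpha> = (map Inl \<beta> :: ('e + 'v) list)"
            using that by (metis length_map stake_shift take_all order_refl diff_self_eq_0 stake.simps(1) append_Nil2)
          then show ?thesis by (simp add: inj_map_eq_map)
        qed
        then show "Poly_Mapping.lookup (if prepend \<alpha> ?p = prepend \<beta> ?p
          then Poly_Mapping.single (int (length \<beta>)) (k \<beta>) else 0) (int (length \<alpha>)) = (if \<beta> = \<alpha> then k \<beta> else 0)"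
          by (auto simp: lookup_single when_def)
      qed
      also have "\<dots> = k \<alpha>" using \<Phi>(1) \<alpha> by simp
      finally show ?thesis ..
    qed
    then show ?thesis by simp
  qed
  with y show ?thesis by (rule eqv_trans)
qed

text \<open>
  In the induction \<open>y\<close> collects the terms already processed: the next term \<open>edge_word \<alpha> * pr A\<close> is
  moved into \<open>y\<close> on \<open>B \<inter> A\<close> and vanishes on \<open>B - A\<close>.
\<close>

lemma ghost_free_uniform_vanish:
  assumes "ghost_free z" "B \<in> gen_verts G" "uniform B y"
    and "\<And>v. v \<in> B \<Longrightarrow> act G (y + z * pr B) (delta (greedy_path G v)) = (\<lambda>x. 0)"
  shows "y + z * pr B \<approx> 0"
  using assms
proof (induction z arbitrary: B y rule: ghost_free.induct)
  case zero
  then show ?case using uniform_vanish[of B y] by simp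
next
  case (eqv x z)
  have e: "y + z * pr B \<approx> y + x * pr B"
    using eqv by (intro eqv_add eqv_refl eqv_right) auto
  then have "y + x * pr B \<approx> 0" using eqv.IH[OF eqv.prems(1,2)] eqv.prems(3) eqv_act[OF e] by simp
  then show ?case using e eqv_trans by blast
next
  case (add x A \<alpha> c)
  let ?m = "scalar c * edge_word \<alpha>"
  let ?z = "?m * pr A + x"
  have U: "?m \<in> U" "x \<in> U" "?m * pr A \<in> U" "?z \<in> U" using add by (auto intro: ghost_free_U)
  obtain \<Phi> k where \<Phi>: "\<And>\<alpha>. \<alpha> \<in> \<Phi> \<Longrightarrow> set \<alpha> \<subseteq> edges G"
    and y: "y \<approx> (\<Sum>\<alpha>\<in>\<Phi>. scalar (k \<alpha>) * edge_word \<alpha> * pr B)" (is "_ \<approx> ?s")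
    using add.prems(2) unfolding uniform_def by blast
  have s: "?s \<in> U" using \<Phi> add.prems(1) by (intro unital_free_alg_sum) auto
  have yU: "y \<in> U" using y s by (rule eqv_U)
  have yB: "y * pr B \<approx> y"
  proof -
    have "y * pr B \<approx> ?s * pr B" using add by (intro eqv_right[OF y]) auto
    also have "?s * pr B = (\<Sum>\<alpha>\<in>\<Phi>. scalar (k \<alpha>) * edge_word \<alpha> * pr B * pr B)"
      by (simp add: sum_distrib_right)
    also have "\<dots> \<approx> (\<Sum>\<alpha>\<in>\<Phi>. scalar (k \<alpha>) * edge_word \<alpha> * pr (B \<inter> B))"
      using \<Phi> add by (intro eqv_sum pr_pr_right) auto
    also have "\<dots> \<approx> y" using eqv_sym[OF y] by simp
    finally show ?thesis .
  qed
  let ?a = "y + ?z * pr B"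
  \<comment> \<open>On a piece \<open>C\<close> where the leading term has been absorbed into a
    uniform \<open>y'\<close>, only \<open>x\<close> is left, and the induction hypothesis applies
    with \<open>C\<close> and \<open>y'\<close> in place of \<open>B\<close> and
    \<open>y\<close>.\<close>
  have step: "?a * pr C \<approx> 0"
    if C: "C \<in> gen_verts G" "C \<subseteq> B" and uy: "uniform C y'"
      and y': "y' \<approx> y * pr C + ?m * pr (A \<inter> C)" for C y'
  proof -
    have BC: "B \<inter> C = C" using C by auto
    have "?a * pr C = y * pr C + ?z * pr B * pr C" by (simp add: distrib_right)
    also have "\<dots> \<approx> y * pr C + ?z * pr (B \<inter> C)"
      using U C add by (intro eqv_add eqv_refl pr_pr_right) auto
    also have "\<dots> = y * pr C + ?m * pr A * pr C + x * pr C"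
      by (simp add: BC distrib_right add.assoc)
    also have "\<dots> \<approx> y * pr C + ?m * pr (A \<inter> C) + x * pr C"
      using U C add by (intro eqv_add eqv_refl pr_pr_right) auto
    also have "\<dots> \<approx> y' + x * pr C"
      by (intro eqv_add eqv_refl eqv_sym[OF y'])
    finally have e: "?a * pr C \<approx> y' + x * pr C" .
    have "act G (y' + x * pr C) (delta (greedy_path G v)) = (\<lambda>x. 0)" if v: "v \<in> C" for v
    proof -
      have "bpath G (greedy_path G v)"
        using v C(1) gen_verts_subset bpath_greedy_path by blast
      then have "act G (?a * pr C) (delta (greedy_path G v)) = act G ?a (delta (greedy_path G v))"
        using v by (simp add: act_mult act_pr_delta del: act_gen)
      also have "\<dots> = (\<lambda>x. 0)" using add.prems(3) v C(2) by blast
      finally show ?thesis using eqv_act[OF e] by simp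
    qed
    from add.IH[OF C(1) uy this] show ?thesis using e eqv_trans by blast
  qed
  have 1: "?a * pr (B \<inter> A) \<approx> 0"
  proof (rule step)
    show "uniform (B \<inter> A) (y * pr (B \<inter> A) + ?m * pr (B \<inter> A))"
      using add by (intro uniform_plus_term uniform_restrict[of B]) auto
    show "y * pr (B \<inter> A) + ?m * pr (B \<inter> A) \<approx> y * pr (B \<inter> A) + ?m * pr (A \<inter> (B \<inter> A))"
      by (simp add: Int_commute)
  qed (use add in auto)
  have 2: "?a * pr (B - A) \<approx> 0"
  proof (rule step)
    show "uniform (B - A) (y * pr (B - A))"
      using add by (intro uniform_restrict[of B]) auto
    have "y * pr (B - A) + ?m * pr {} \<approx> y * pr (B - A) + 0"
      using U by (intro eqv_add eqv_refl pr_empty_right) auto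
    moreover have "A \<inter> (B - A) = {}" by auto
    ultimately show "y * pr (B - A) \<approx> y * pr (B - A) + ?m * pr (A \<inter> (B - A))"
      by (simp add: eqv_sym)
  qed (use add in auto)
  have "?a * pr B \<approx> ?a * (pr (B \<inter> A) + pr (B - A))"
  proof (rule eqv_left)
    have "B \<inter> A \<union> (B - A) = B" by auto
    then show "pr B \<approx> pr (B \<inter> A) + pr (B - A)"
      using pr_disjoint_union[of "B \<inter> A" "B - A"] add by auto
  qed (use U yU add in auto)
  also have "\<dots> \<approx> 0 + 0" unfolding distrib_left by (intro eqv_add 1 2)
  finally have 3: "?a * pr B \<approx> 0" by simp
  have "?a * pr B = y * pr B + ?z * pr B * pr B" by (simp add: distrib_right)
  also have "\<dots> \<approx> y + ?z * pr (B \<inter> B)"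
    using U add by (intro eqv_add yB pr_pr_right) auto
  finally have "?a * pr B \<approx> ?a" by simp
  then show ?case using 3 eqv_sym eqv_trans by blast
qed

text \<open>The preceding induction started with nothing processed. \<open>B\<close> need not
  support \<open>z\<close>: testing at the greedy paths from \<open>B\<close> controls exactly the
  part \<open>z * pr B\<close>.\<close>

lemma ghost_free_vanish:
  assumes "ghost_free z" "B \<in> gen_verts G"
    and "\<And>v. v \<in> B \<Longrightarrow> act G z (delta (greedy_path G v)) = (\<lambda>x. 0)"
  shows "z * pr B \<approx> 0"
proof -
  have "act G (0 + z * pr B) (delta (greedy_path G v)) = (\<lambda>x. 0)" if v: "v \<in> B" for v
  proof -
    have "bpath G (greedy_path G v)"
      using v assms(2) gen_verts_subset bpath_greedy_path by blast
    then show ?thesis using v assms(3)[OF v] by (simp add: act_mult act_pr_delta del: act_gen)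
  qed
  from ghost_free_uniform_vanish[OF assms(1,2) uniform_zero this] show ?thesis by simp
qed

text \<open>\<open>n\<close> bounds the number of ghost letters at the right end of each term, after
  reduction to the order edges, projection, ghosts. Being only a bound, it can be raised to a common
  value for sums.\<close>

inductive ghost_depth :: "nat \<Rightarrow> (('v, 'e) lpa_gen word \<Rightarrow>\<^sub>0 'k) \<Rightarrow> bool" where
  free: "ghost_free x \<Longrightarrow> ghost_depth n x"
| plus: "ghost_depth n x \<Longrightarrow> ghost_depth n y \<Longrightarrow> ghost_depth n (x + y)"
| ghost: "ghost_depth n x \<Longrightarrow> e \<in> edges G \<Longrightarrow> ghost_depth (Suc n) (x * gh e)"
| eqv: "ghost_depth n x \<Longrightarrow> y \<approx> x \<Longrightarrow> ghost_depth n y"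

lemma ghost_depth_U: "ghost_depth n x \<Longrightarrow> x \<in> U"
  by (induction rule: ghost_depth.induct) (auto intro: eqv_U ghost_free_U)

lemma ghost_depth_zero: "ghost_depth 0 x \<Longrightarrow> ghost_free x"
  by (induction "0 :: nat" x rule: ghost_depth.induct) (auto intro: ghost_free_plus ghost_free.eqv)

lemma ghost_depth_mono: "ghost_depth n x \<Longrightarrow> n \<le> m \<Longrightarrow> ghost_depth m x"
proof (induction arbitrary: m rule: ghost_depth.induct)
  case (ghost n x e)
  then obtain m' where "m = Suc m'" "n \<le> m'" by (cases m) auto
  then show ?case using ghost by (auto intro: ghost_depth.ghost)
qed (auto intro: ghost_depth.intros)

lemma ghost_depth_pr: "ghost_depth n x \<Longrightarrow> A \<in> gen_verts G \<Longrightarrow> ghost_depth n (x * pr A)"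
proof (induction rule: ghost_depth.induct)
  case (free x n)
  then show ?case by (intro ghost_depth.free ghost_free_pr)
next
  case (plus n x y)
  then show ?case by (simp add: distrib_right ghost_depth.plus)
next
  case (ghost n x e)
  have "x * gh e * pr A \<approx> x * (if source_of G e \<in> A then gh e else 0)"
    unfolding mult.assoc using ghost ghost_depth_U by (intro eqv_left gh_pr) auto
  moreover have "ghost_depth (Suc n) (x * (if source_of G e \<in> A then gh e else 0))"
    using ghost by (auto intro: ghost_depth.ghost ghost_depth.free ghost_free.zero)
  ultimately show ?case by (blast intro: ghost_depth.eqv)
next
  case (eqv n x y)
  then show ?case by (blast intro: ghost_depth.eqv eqv_right pr_U)
qed

text \<open>By relation (3) the edge meets the last ghost letter and leaves a projection or 0. The
  truncated \<open>n - 1\<close> also fits depth 0, where right multiplication by an edge stays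
  ghost-free.\<close>

lemma ghost_depth_ed: "ghost_depth n x \<Longrightarrow> f \<in> edges G \<Longrightarrow> ghost_depth (n - 1) (x * ed f)"
proof (induction rule: ghost_depth.induct)
  case (free x n)
  then show ?case by (intro ghost_depth.free ghost_free_ed)
next
  case (plus n x y)
  then show ?case by (simp add: distrib_right ghost_depth.plus)
next
  case (ghost n x e)
  have "x * gh e * ed f \<approx> x * (if e = f then pr (range_of G e) else 0)"
    unfolding mult.assoc using ghost ghost_depth_U by (intro eqv_left gh_ed) auto
  moreover have "ghost_depth n (x * (if e = f then pr (range_of G e) else 0))"
    using ghost by (auto intro: ghost_depth_pr ghost_depth.free ghost_free.zero)
  ultimately show ?case by (auto intro: ghost_depth.eqv)
next
  case (eqv n x y)
  then show ?case by (blast intro: ghost_depth.eqv eqv_right ed_U)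
qed

text \<open>Words grow by right multiplication with letters, under which bounded depth is preserved.
  The start is a single letter, to which relation (2) supplies a projection if it is an edge or a
  ghost.\<close>

lemma ghost_depth_word:
  assumes "ls \<noteq> []" "set ls \<subseteq> lpa_gens G"
  shows "\<exists>n. ghost_depth n (Poly_Mapping.single (Word ls) c)"
  using assms
proof (induction ls rule: rev_induct)
  case Nil
  then show ?case by simp
next
  case (snoc g ls)
  have g: "g \<in> lpa_gens G" using snoc by simp
  have cat: "Poly_Mapping.single (Word (ls @ [g])) c = Poly_Mapping.single (Word ls) c * gen g"
    by (simp add: gen_def mult_single plus_word_def)
  show ?case
  proof (cases "ls = []")
    case True
    then have s: "Poly_Mapping.single (Word (ls @ [g])) c = scalar c * gen g"
      unfolding cat by (simp add: scalar_def zero_word_def)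
    consider A where "g = Proj A" "A \<in> gen_verts G" | e where "g = Edge e" "e \<in> edges G"
      | e where "g = Ghost e" "e \<in> edges G" using g by (auto simp: lpa_gens_def)
    then show ?thesis
    proof cases
      case 1
      then have "ghost_free (scalar c * edge_word [] * pr A)"
        using gen_verts_subset bpath_greedy_path by (intro ghost_free_term) auto
      then show ?thesis unfolding s using 1 ghost_depth.free by auto
    next
      case 2
      have "ghost_free (scalar c * edge_word [e] * pr (range_of G e))"
        using 2 range_subset_verts bpath_greedy_path by (intro ghost_free_term) auto
      moreover have "scalar c * ed e \<approx> scalar c * (ed e * pr (range_of G e))"
        using 2 by (intro eqv_left eqv_sym[OF ed_range]) auto
      ultimately have "ghost_free (scalar c * ed e)"
        by (auto simp: mult.assoc elim: ghost_free.eqv)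
      then show ?thesis unfolding s using 2 ghost_depth.free by auto
    next
      case 3
      have "ghost_free (scalar c * edge_word [] * pr (range_of G e))"
        using 3 range_subset_verts bpath_greedy_path by (intro ghost_free_term) auto
      then have "ghost_depth (Suc 0) (scalar c * pr (range_of G e) * gh e)"
        using 3 by (intro ghost_depth.ghost ghost_depth.free) auto
      moreover have "scalar c * gh e \<approx> scalar c * (pr (range_of G e) * gh e)"
        using 3 by (intro eqv_left eqv_sym[OF range_gh]) auto
      ultimately have "ghost_depth (Suc 0) (scalar c * gh e)"
        by (auto simp: mult.assoc elim: ghost_depth.eqv)
      then show ?thesis unfolding s using 3 by auto
    qed
  next
    case False
    then obtain n where n: "ghost_depth n (Poly_Mapping.single (Word ls) c)" using snoc by auto
    have "g \<in> Proj ` gen_verts G \<union> Edge ` edges G \<union> Ghost ` edges G" using g by (simp add: lpa_gens_def)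
    then have "\<exists>m. ghost_depth m (Poly_Mapping.single (Word ls) c * gen g)"
      using ghost_depth_pr[OF n] ghost_depth_ed[OF n] ghost_depth.ghost[OF n] by blast
    then show ?thesis unfolding cat .
  qed
qed

lemma ghost_depth_exists:
  assumes "a \<in> carrier (free_alg TYPE('k) (lpa_gens G))"
  shows "\<exists>n. ghost_depth n a"
proof -
  have "\<exists>n. ghost_depth n (\<Sum>w\<in>S. Poly_Mapping.single w (Poly_Mapping.lookup a w))"
    if "finite S" "S \<subseteq> Poly_Mapping.keys a" for S
    using that
  proof (induction S rule: finite_induct)
    case empty
    then show ?case using ghost_depth.free ghost_free.zero by auto
  next
    case (insert w S)
    then obtain n where n: "ghost_depth n (\<Sum>w\<in>S. Poly_Mapping.single w (Poly_Mapping.lookup a w))"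
      by auto
    obtain m where m: "ghost_depth m (Poly_Mapping.single w (Poly_Mapping.lookup a w))"
    proof -
      have "letters w \<noteq> []" "set (letters w) \<subseteq> lpa_gens G"
        using assms insert.prems by (auto simp: free_alg_def)
      then show ?thesis
        using ghost_depth_word[of "letters w" "Poly_Mapping.lookup a w"] that by auto
    qed
    have "ghost_depth (max n m) (Poly_Mapping.single w (Poly_Mapping.lookup a w) +
        (\<Sum>w\<in>S. Poly_Mapping.single w (Poly_Mapping.lookup a w)))"
      by (intro ghost_depth.plus ghost_depth_mono[OF m] ghost_depth_mono[OF n]) auto
    then show ?case using insert by auto
  qed
  from this[OF finite_keys order_refl] show ?thesis
    unfolding poly_mapping_sum_single[of a, symmetric] .
qed

section \<open>Separating the ghost-free part, and faithfulness\<close>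

abbreviation edge_sum :: "'e set \<Rightarrow> ('v, 'e) lpa_gen word \<Rightarrow>\<^sub>0 'k" where
  "edge_sum F \<equiv> (\<Sum>e\<in>F. ed e * gh e)"

lemma edge_sum_U: "F \<subseteq> edges G \<Longrightarrow> edge_sum F \<in> U"
  by (intro unital_free_alg_sum) auto

lemma gh_edge_sum:
  assumes "finite F" "F \<subseteq> edges G" "e \<in> F"
  shows "gh e * edge_sum F \<approx> gh e"
proof -
  have e: "e \<in> edges G" using assms by auto
  have "gh e * edge_sum F = (\<Sum>f\<in>F. gh e * ed f * gh f)"
    by (simp add: sum_distrib_left mult.assoc)
  also have "\<dots> \<approx> (\<Sum>f\<in>F. (if e = f then pr (range_of G e) else 0) * gh f)"
    using assms by (intro eqv_sum eqv_right gh_ed) auto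
  also have "\<dots> = (\<Sum>f\<in>F. if e = f then pr (range_of G e) * gh f else 0)"
    by (intro sum.cong) auto
  also have "\<dots> = pr (range_of G e) * gh e" using assms by simp
  also have "\<dots> \<approx> gh e" using e by (rule range_gh)
  finally show ?thesis .
qed

text \<open>\<open>edge_sum E\<close> is absorbed by \<open>edge_sum F\<close> when multiplied by it
  on the right, so \<open>1 - edge_sum F\<close> is congruent to
  \<open>(1 - edge_sum E) * (1 - edge_sum F)\<close>. This lets two summands share one set of
  edges.\<close>

lemma edge_sum_mono:
  assumes z: "z \<in> U" "z * (1 - edge_sum E) \<approx> 0" and F: "finite F" "F \<subseteq> edges G" "E \<subseteq> F"
  shows "z * (1 - edge_sum F) \<approx> 0"
proof -
  have E: "E \<subseteq> edges G" using F by auto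
  have "edge_sum E * edge_sum F = (\<Sum>e\<in>E. ed e * (gh e * edge_sum F))"
    by (simp add: sum_distrib_right mult.assoc)
  also have "\<dots> \<approx> edge_sum E"
    using F by (intro eqv_sum eqv_left gh_edge_sum) auto
  finally have EF: "edge_sum E * edge_sum F \<approx> edge_sum E" .
  have "z * (1 - edge_sum F) = z * (1 - edge_sum E) * (1 - edge_sum F) + z * (edge_sum E - edge_sum E * edge_sum F)"
    by (simp add: algebra_simps)
  also have "\<dots> \<approx> 0 * (1 - edge_sum F) + z * (edge_sum E - edge_sum E)"
    using z F E EF edge_sum_U by (intro eqv_add eqv_right eqv_left eqv_diff eqv_refl) auto
  finally show ?thesis by simp
qed

text \<open>Up to congruence \<open>x\<close> is a ghost-free \<open>y\<close> plus terms ending in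
  a ghost edge. \<open>F\<close> collects these last ghost edges, and
  \<open>gh e * (1 - edge_sum F)\<close> is congruent to 0 for \<open>e\<close> in
  \<open>F\<close>.\<close>

lemma ghost_depth_decomp:
  "ghost_depth n x \<Longrightarrow> \<exists>y F. ghost_free y \<and> finite F \<and> F \<subseteq> edges G \<and> (x - y) * (1 - edge_sum F) \<approx> 0"
proof (induction rule: ghost_depth.induct)
  case (free x n)
  then show ?case by (intro exI[of _ x] exI[of _ "{}"]) auto
next
  case (plus n x x')
  then obtain y F y' F' where y: "ghost_free y" "finite F" "F \<subseteq> edges G" "(x - y) * (1 - edge_sum F) \<approx> 0"
    and y': "ghost_free y'" "finite F'" "F' \<subseteq> edges G" "(x' - y') * (1 - edge_sum F') \<approx> 0"
    by blast
  have "(x - y) * (1 - edge_sum (F \<union> F')) \<approx> 0"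
    using y y' plus ghost_depth_U ghost_free_U by (intro edge_sum_mono[OF _ y(4)]) auto
  moreover have "(x' - y') * (1 - edge_sum (F \<union> F')) \<approx> 0"
    using y y' plus ghost_depth_U ghost_free_U by (intro edge_sum_mono[OF _ y'(4)]) auto
  ultimately have "(x - y) * (1 - edge_sum (F \<union> F')) + (x' - y') * (1 - edge_sum (F \<union> F')) \<approx> 0 + 0"
    by (rule eqv_add)
  then have "((x + x') - (y + y')) * (1 - edge_sum (F \<union> F')) \<approx> 0"
    by (simp add: algebra_simps)
  then show ?case using y y' ghost_free_plus by (intro exI[of _ "y + y'"] exI[of _ "F \<union> F'"]) auto
next
  case (ghost n x e)
  have "(x * gh e - 0) * (1 - edge_sum {e}) = x * (gh e - gh e * edge_sum {e})"
    by (simp add: algebra_simps)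
  also have "\<dots> \<approx> x * (gh e - gh e)"
    using ghost ghost_depth_U by (intro eqv_left eqv_diff eqv_refl gh_edge_sum) auto
  finally show ?case using ghost ghost_free.zero by (intro exI[of _ 0] exI[of _ "{e}"]) auto
next
  case (eqv n x x')
  then obtain y F where y: "ghost_free y" "finite F" "F \<subseteq> edges G" "(x - y) * (1 - edge_sum F) \<approx> 0"
    by blast
  have "(x' - y) * (1 - edge_sum F) \<approx> (x - y) * (1 - edge_sum F)"
    using eqv y edge_sum_U by (intro eqv_right eqv_diff eqv_refl) auto
  then show ?case using y eqv_trans by blast
qed

lemma finite_gen_verts: "finite S \<Longrightarrow> S \<subseteq> verts G \<Longrightarrow> S \<in> gen_verts G"
proof (induction S rule: finite_induct)
  case (insert v S)
  then have "{v} \<union> S \<in> gen_verts G" by (intro gen_verts.union gen_verts.singleton) auto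
  then show ?case by simp
qed simp

lemma finite_pr_zero:
  assumes "finite S" "S \<subseteq> verts G" "x \<in> U" "\<And>v. v \<in> S \<Longrightarrow> x * pr {v} \<approx> 0"
  shows "x * pr S \<approx> 0"
  using assms
proof (induction S rule: finite_induct)
  case empty
  then show ?case by (intro pr_empty_right)
next
  case (insert v S)
  have "x * pr ({v} \<union> S) \<approx> x * (pr {v} + pr S)"
    using insert finite_gen_verts by (intro eqv_left pr_disjoint_union) auto
  also have "\<dots> \<approx> 0 + 0" unfolding distrib_left using insert by (intro eqv_add) auto
  finally show ?case by simp
qed

text \<open>On either side \<open>pr S\<close> selects the summands whose edge starts in
  \<open>S\<close>.\<close>

lemma pr_edge_sum_commute:
  assumes "S \<in> gen_verts G" "F \<subseteq> edges G"
  shows "pr S * edge_sum F \<approx> edge_sum F * pr S"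
proof -
  have 1: "pr S * ed e * gh e \<approx> (if source_of G e \<in> S then ed e else 0) * gh e" if "e \<in> F" for e
    using assms that by (intro eqv_right pr_ed) auto
  have 2: "ed e * (gh e * pr S) \<approx> ed e * (if source_of G e \<in> S then gh e else 0)" if "e \<in> F" for e
    using assms that by (intro eqv_left gh_pr) auto
  have "pr S * edge_sum F = (\<Sum>e\<in>F. pr S * ed e * gh e)"
    by (simp add: sum_distrib_left mult.assoc)
  also have "\<dots> \<approx> (\<Sum>e\<in>F. ed e * (gh e * pr S))"
  proof (rule eqv_sum)
    fix e assume e: "e \<in> F"
    show "pr S * ed e * gh e \<approx> ed e * (gh e * pr S)"
      using eqv_trans[OF 1[OF e]] eqv_sym[OF 2[OF e]] by (cases "source_of G e \<in> S") auto
  qed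
  also have "\<dots> = edge_sum F * pr S" by (simp add: sum_distrib_right mult.assoc)
  finally show ?thesis .
qed

text \<open>Induction shows that all \<open>x * ed e\<close> are congruent to 0. Then
  \<open>x\<close> is congruent to \<open>y * (1 - edge_sum F)\<close> with \<open>y\<close>
  ghost-free, and test paths that do not begin in \<open>F\<close> confine \<open>y\<close> to a
  finite set \<open>S\<close> of regular vertices, where relation (4) finishes.\<close>

lemma ghost_depth_faithful:
  assumes "ghost_depth n x" "\<And>p. bpath G p \<Longrightarrow> act G x (delta p) = (\<lambda>x. 0)"
  shows "x \<approx> 0"
  using assms
proof (induction n arbitrary: x)
  case 0
  from 0(1) have x: "ghost_free x" by (rule ghost_depth_zero)
  then obtain B where B: "B \<in> gen_verts G" "x * pr B \<approx> x" using ghost_free_support by blast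
  have "x * pr B \<approx> 0"
    using x B(1)
  proof (rule ghost_free_vanish)
    fix v assume "v \<in> B"
    then have "bpath G (greedy_path G v)"
      using B(1) gen_verts_subset bpath_greedy_path by blast
    then show "act G x (delta (greedy_path G v)) = (\<lambda>x. 0)" by (rule 0(2))
  qed
  with eqv_sym[OF B(2)] show ?case by (rule eqv_trans)
next
  case (Suc n)
  have xU: "x \<in> U" using Suc.prems(1) by (rule ghost_depth_U)
  \<comment> \<open>\<open>ed e\<close> lowers the depth and sends a delta function to 0 or to
    \<open>t\<close> times another one, so the induction hypothesis applies.\<close>
  have xe: "x * ed e \<approx> 0" if e: "e \<in> edges G" for e
  proof (rule Suc.IH)
    show "ghost_depth n (x * ed e)" using ghost_depth_ed[OF Suc.prems(1) e] by simp
    show "act G (x * ed e) (delta p) = (\<lambda>x. 0)" if "bpath G p" for p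
      using Suc.prems(2)[of "Inl e ## p"]
      by (cases "bpath G (Inl e ## p)")
        (simp_all add: act_mult letter_act_Edge_delta act_scale_arg del: letter_act.simps bpath_Stream_Inl)
  qed
  obtain y F where y: "ghost_free y" and F: "finite F" "F \<subseteq> edges G"
    and xy: "(x - y) * (1 - edge_sum F) \<approx> 0"
    using ghost_depth_decomp[OF Suc.prems(1)] by blast
  have yU: "y \<in> U" using y by (rule ghost_free_U)
  have FU: "edge_sum F \<in> U" using F(2) by (rule edge_sum_U)
  have "x * edge_sum F = (\<Sum>e\<in>F. x * ed e * gh e)" by (simp add: sum_distrib_left mult.assoc)
  also have "\<dots> \<approx> (\<Sum>e\<in>F. 0)" using F by (intro eqv_sum eqv_zero_right[OF xe]) auto
  finally have xF: "x * edge_sum F \<approx> 0" by simp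
  \<comment> \<open>\<open>x\<close> is congruent to \<open>x * (1 - edge_sum F)\<close>, and this
    factor removes the part of \<open>x\<close> that ends in ghost edges.\<close>
  have "y * (1 - edge_sum F) = x - x * edge_sum F - (x - y) * (1 - edge_sum F)"
    by (simp add: algebra_simps)
  also have "\<dots> \<approx> x - 0 - 0" by (intro eqv_diff eqv_refl xF xy)
  finally have yx: "y * (1 - edge_sum F) \<approx> x" by simp
  obtain C where C: "C \<in> gen_verts G" "y * pr C \<approx> y" using ghost_free_support[OF y] by blast
  \<comment> \<open>Finite because \<open>F\<close> is; these are the vertices of \<open>C\<close>
    whose greedy path could begin with an edge of \<open>F\<close>.\<close>
  define S where "S = {v \<in> C. regular_vertex G v} \<inter> source_of G ` F"
  have S: "finite S" "S \<subseteq> verts G"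
    using F(1) by (auto simp: S_def regular_vertex_def)
  then have Sg: "S \<in> gen_verts G" by (rule finite_gen_verts)
  have "y * pr (C - S) \<approx> 0"
  proof (rule ghost_free_vanish[OF y])
    show "C - S \<in> gen_verts G" using C Sg by simp
    fix v assume v: "v \<in> C - S"
    then have p: "bpath G (greedy_path G v)"
      using C(1) gen_verts_subset bpath_greedy_path by blast
    let ?d = "delta (greedy_path G v) :: _ \<Rightarrow> 'k laurent"
    have "act G (ed e * gh e) ?d = (\<lambda>x. 0)" if e: "e \<in> F" for e
    proof -
      \<comment> \<open>Beginning with \<open>e\<close> in \<open>F\<close> would make
        \<open>v\<close> regular and the source of \<open>e\<close>, hence a member of
        \<open>S\<close>. So \<open>1 - edge_sum F\<close> fixes this delta function, and
        \<open>y\<close> acts on it as \<open>x\<close> does.\<close>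
      have "shd (greedy_path G v) \<noteq> Inl e"
      proof
        assume h: "shd (greedy_path G v) = Inl e"
        then have "regular_vertex G v" by (simp add: greedy_path.simps split: if_splits)
        moreover have "source_of G e = v" using h source_greedy_path[of G v] by simp
        ultimately show False using v e by (auto simp: S_def)
      qed
      then show ?thesis
        by (simp add: act_mult letter_act_Ghost_delta[OF p] letter_act_zero del: letter_act.simps)
    qed
    then have "act G (1 - edge_sum F) ?d = ?d" by (simp add: fun_eq_iff act_diff act_sum)
    then have "act G y ?d = act G (y * (1 - edge_sum F)) ?d" by (simp add: act_mult)
    also have "\<dots> = (\<lambda>x. 0)" using eqv_act[OF yx] Suc.prems(2)[OF p] by simp
    finally show "act G y ?d = (\<lambda>x. 0)" .
  qed
  have "y \<approx> y * pr C" by (rule eqv_sym[OF C(2)])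
  also have "y * pr C \<approx> y * (pr (C - S) + pr S)"
  proof (rule eqv_left[OF _ yU])
    have "C - S \<union> S = C" by (auto simp: S_def)
    then show "pr C \<approx> pr (C - S) + pr S"
      using pr_disjoint_union[of "C - S" S] C Sg by auto
  qed
  also have "\<dots> \<approx> 0 + y * pr S" unfolding distrib_left by (intro eqv_add eqv_refl) fact
  finally have yS: "y \<approx> y * pr S" by simp
  \<comment> \<open>The factor \<open>pr S\<close> is carried from \<open>y\<close> past
    \<open>1 - edge_sum F\<close> to the right end, which gives \<open>x\<close> congruent to
    \<open>x * pr S\<close>.\<close>
  have "x \<approx> y * (1 - edge_sum F)" by (rule eqv_sym[OF yx])
  also have "\<dots> \<approx> y * pr S * (1 - edge_sum F)" using FU by (intro eqv_right yS) auto
  also have "\<dots> = y * (pr S - pr S * edge_sum F)" by (simp add: algebra_simps)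
  also have "\<dots> \<approx> y * (pr S - edge_sum F * pr S)"
    using Sg F yU by (intro eqv_left eqv_diff eqv_refl pr_edge_sum_commute)
  also have "\<dots> = y * (1 - edge_sum F) * pr S" by (simp add: algebra_simps)
  also have "\<dots> \<approx> x * pr S" using Sg by (intro eqv_right yx) auto
  also have "\<dots> \<approx> 0"
    using S xU
  proof (rule finite_pr_zero)
    fix v assume "v \<in> S"
    then have v: "regular_vertex G v" by (simp add: S_def)
    let ?E = "{e \<in> edges G. source_of G e = v}"
    have "x * pr {v} \<approx> x * edge_sum ?E" using v xU by (intro eqv_left pr_regular)
    also have "\<dots> = (\<Sum>e\<in>?E. x * ed e * gh e)" by (simp add: sum_distrib_left mult.assoc)
    also have "\<dots> \<approx> (\<Sum>e\<in>?E. 0)" by (intro eqv_sum eqv_zero_right[OF xe]) auto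
    finally show "x * pr {v} \<approx> 0" by simp
  qed
  finally show ?case .
qed

lemma act_faithful:
  assumes "a \<in> carrier (free_alg TYPE('k) (lpa_gens G))"
    and "\<And>p. bpath G p \<Longrightarrow> act G a (delta p) = (\<lambda>x. 0)"
  shows "a \<in> I"
  using ghost_depth_faithful[OF _ assms(2)] ghost_depth_exists[OF assms(1)] eqv_zero_iff by blast

end

section \<open>Eigenvectors of multiples of an element\<close>

primrec star_letter :: "('v, 'e) lpa_gen \<Rightarrow> ('v, 'e) lpa_gen" where
  "star_letter (Proj A) = Proj A"
| "star_letter (Edge e) = Ghost e"
| "star_letter (Ghost e) = Edge e"

text \<open>The involution of the algebra, on words.\<close>

definition star :: "('v, 'e) lpa_gen list \<Rightarrow> ('v, 'e) lpa_gen list" where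
  "star w = rev (map star_letter w)"

lemma letter_act_delta:
  assumes "bpath G p"
  shows "letter_act G g (delta p) = (\<lambda>x. 0 :: 'k::field laurent) \<or>
    (\<exists>n q. bpath G q \<and> letter_act G g (delta p) = (\<lambda>x. tpow n * delta q x :: 'k laurent) \<and>
      letter_act G (star_letter g) (delta q) = (\<lambda>x. tpow (- n) * delta p x :: 'k laurent))"
proof (cases g)
  case (Proj A)
  show ?thesis
  proof (cases "source G (shd p) \<in> A")
    case True
    then show ?thesis using Proj assms
      by (intro disjI2 exI[of _ 0] exI[of _ p]) (simp add: letter_act_Proj_delta del: letter_act.simps)
  qed (use Proj assms in \<open>simp add: letter_act_Proj_delta del: letter_act.simps\<close>)
next
  case (Edge e)
  show ?thesis
  proof (cases "bpath G (Inl e ## p)")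
    case True
    then show ?thesis using Edge
      by (intro disjI2 exI[of _ 1] exI[of _ "Inl e ## p"])
        (simp add: letter_act_Edge_delta letter_act_Ghost_delta del: letter_act.simps bpath_Stream_Inl)
  qed (use Edge in \<open>simp add: letter_act_Edge_delta del: letter_act.simps bpath_Stream_Inl\<close>)
next
  case (Ghost e)
  show ?thesis
  proof (cases "shd p = Inl e")
    case True
    have p: "Inl e ## stl p = p" using True by (metis stream.collapse)
    show ?thesis using Ghost True assms bpath_Inl(4)[OF assms True]
      by (intro disjI2 exI[of _ "- 1"] exI[of _ "stl p"])
        (simp add: letter_act_Edge_delta letter_act_Ghost_delta p del: letter_act.simps bpath_Stream_Inl)
  qed (use Ghost assms in \<open>simp add: letter_act_Ghost_delta del: letter_act.simps\<close>)
qed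

text \<open>Deleting an edge undoes prepending it, so letters, and hence words, act on delta
  functions as partial injections of paths times a power of \<open>t\<close>, with the reversed word
  as inverse.\<close>

lemma word_act_delta:
  assumes "bpath G p"
  shows "word_act G w (delta p) = (\<lambda>x. 0 :: 'k::field laurent) \<or>
    (\<exists>n q. bpath G q \<and> word_act G w (delta p) = (\<lambda>x. tpow n * delta q x :: 'k laurent) \<and>
      word_act G (star w) (delta q) = (\<lambda>x. tpow (- n) * delta p x :: 'k laurent))"
proof (induction w)
  case Nil
  show ?case using assms by (intro disjI2 exI[of _ 0] exI[of _ p]) (simp add: star_def)
next
  case (Cons g w)
  show ?case
  proof (cases "word_act G w (delta p) = (\<lambda>x. 0 :: 'k laurent)")
    case True
    then show ?thesis by (simp add: letter_act_zero)
  next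
    case False
    then obtain n q where q: "bpath G q"
      "word_act G w (delta p) = (\<lambda>x. tpow n * delta q x :: 'k laurent)"
      "word_act G (star w) (delta q) = (\<lambda>x. tpow (- n) * delta p x :: 'k laurent)"
      using Cons by blast
    show ?thesis
    proof (cases "letter_act G g (delta q) = (\<lambda>x. 0 :: 'k laurent)")
      case True
      then show ?thesis by (simp add: q(2) letter_act_scale)
    next
      case False
      then obtain m r where r: "bpath G r"
        "letter_act G g (delta q) = (\<lambda>x. tpow m * delta r x :: 'k laurent)"
        "letter_act G (star_letter g) (delta r) = (\<lambda>x. tpow (- m) * delta q x :: 'k laurent)"
        using letter_act_delta[OF q(1), of g] by blast
      show ?thesis
        using r q by (intro disjI2 exI[of _ "n + m"] exI[of _ r])
          (simp add: star_def word_act_append letter_act_scale word_act_scale tpow_mult_left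
            minus_diff_commute[of m n])
    qed
  qed
qed

lemma word_act_support:
  "w \<noteq> [] \<Longrightarrow> \<not> bpath G x \<Longrightarrow> word_act G w \<psi> x = 0"
  by (cases w; cases "hd w") auto

section \<open>Cutting functions down to a single path\<close>

context ultragraph
begin

lemma star_gens: "set w \<subseteq> lpa_gens G \<Longrightarrow> set (star w) \<subseteq> lpa_gens G"
  by (auto simp: star_def lpa_gens_def)

text \<open>If \<open>p\<close> begins with \<open>e\<close>, the idempotent
  \<open>ed e * gh e\<close> keeps it. If both paths have stopped, the projection at the vertex of
  \<open>p\<close> does.\<close>

lemma cylinder_separates_heads:
  assumes "bpath G p" "bpath G q" "shd p \<noteq> shd q"
  shows "\<exists>a\<in>unital_free_alg (lpa_gens G). \<exists>S. p \<in> S \<and> q \<notin> S \<and>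
    (\<forall>\<phi>. (\<forall>x. \<not> bpath G x \<longrightarrow> \<phi> x = 0) \<longrightarrow>
      act G a \<phi> = (\<lambda>x. if x \<in> S then \<phi> x else (0 :: 'k::field laurent)))"
proof -
  have edge: "act G (ed e * gh e) \<phi> = (\<lambda>x. if shd x = Inl e then \<phi> x else 0)"
    if "\<forall>x. \<not> bpath G x \<longrightarrow> \<phi> x = 0" for e and \<phi> :: "_ \<Rightarrow> 'k laurent"
  proof (rule ext)
    fix x
    show "act G (ed e * gh e) \<phi> x = (if shd x = Inl e then \<phi> x else 0)"
    proof (cases "bpath G x \<and> shd x = Inl e")
      case True
      then have x: "bpath G x" "Inl e ## stl x = x" by (auto intro: stream.expand)
      then show ?thesis using True
        by (simp add: act_mult tpow_mult_left del: bpath_Stream_Inl)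
    qed (use that in \<open>auto simp: act_mult\<close>)
  qed
  show ?thesis
  proof (cases "shd p")
    case (Inl e)
    have "e \<in> edges G" using bpath_Inl(2)[OF assms(1) Inl] .
    then show ?thesis using assms(3) Inl edge
      by (intro bexI[of _ "ed e * gh e"] exI[of _ "{x. shd x = Inl e}"]) auto
  next
    case p: (Inr v)
    show ?thesis
    proof (cases "shd q")
      case (Inl e)
      have "e \<in> edges G" using bpath_Inl(2)[OF assms(2) Inl] .
      then show ?thesis using p Inl edge
        \<comment> \<open>\<open>p\<close> has stopped but may start at the same vertex as
          \<open>q\<close>, so the edge of \<open>q\<close> is excluded by a complement; this uses
          the identity of the larger algebra.\<close>
        by (intro bexI[of _ "1 - ed e * gh e"] exI[of _ "{x. shd x \<noteq> Inl e}"])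
          (auto simp: act_diff fun_eq_iff)
    next
      case (Inr u)
      have "v \<in> verts G" using bpath_Inr(2)[OF assms(1) p] .
      then show ?thesis using p Inr assms(3)
        by (intro bexI[of _ "pr {v}"] exI[of _ "{x. source G (shd x) = v}"]) auto
    qed
  qed
qed

text \<open>Past a common first edge \<open>e\<close>, an element \<open>a\<close> that separates
  the tails is conjugated to \<open>ed e * a * gh e\<close>. A common first entry
  \<open>Inr v\<close> would make the two paths equal.\<close>

lemma cylinder_separates_points:
  assumes "bpath G p" "bpath G q" "snth p n \<noteq> snth q n"
  shows "\<exists>a\<in>unital_free_alg (lpa_gens G). \<exists>S. p \<in> S \<and> q \<notin> S \<and>
    (\<forall>\<phi>. (\<forall>x. \<not> bpath G x \<longrightarrow> \<phi> x = 0) \<longrightarrow>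
      act G a \<phi> = (\<lambda>x. if x \<in> S then \<phi> x else (0 :: 'k::field laurent)))"
  using assms
proof (induction n arbitrary: p q)
  case 0
  then show ?case by (intro cylinder_separates_heads) simp_all
next
  case (Suc n)
  show ?case
  proof (cases "shd p = shd q")
    case False
    then show ?thesis by (rule cylinder_separates_heads[OF Suc(2,3)])
  next
    case True
    show ?thesis
    proof (cases "shd p")
      case (Inr v)
      then have "p = q" using True bpath_Inr(1)[OF Suc(2)] bpath_Inr(1)[OF Suc(3)] by simp
      then show ?thesis using Suc by simp
    next
      case (Inl e)
      then have e: "e \<in> edges G" and pq: "bpath G (stl p)" "bpath G (stl q)"
        using True bpath_Inl[OF Suc(2), of e] bpath_Inl[OF Suc(3), of e] by auto
      obtain a S where a: "a \<in> unital_free_alg (lpa_gens G)" "stl p \<in> S" "stl q \<notin> S"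
        and S: "\<And>\<phi>. (\<forall>x. \<not> bpath G x \<longrightarrow> \<phi> x = 0) \<Longrightarrow>
          act G a \<phi> = (\<lambda>x. if x \<in> S then \<phi> x else (0 :: 'k laurent))"
        using Suc.IH[OF pq] Suc(4) by auto
      have "act G (ed e * a * gh e) \<phi> = (\<lambda>x. if shd x = Inl e \<and> stl x \<in> S then \<phi> x else 0)"
        if \<phi>: "\<forall>x. \<not> bpath G x \<longrightarrow> \<phi> x = 0" for \<phi> :: "_ \<Rightarrow> 'k laurent"
      proof (rule ext)
        fix x
        have g: "act G a (letter_act G (Ghost e) \<phi>) =
          (\<lambda>x. if x \<in> S then letter_act G (Ghost e) \<phi> x else 0)"
          by (rule S) auto
        show "act G (ed e * a * gh e) \<phi> x = (if shd x = Inl e \<and> stl x \<in> S then \<phi> x else 0)"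
        proof (cases "bpath G x \<and> shd x = Inl e")
          case True
          then have x: "bpath G x" "Inl e ## stl x = x" by (auto intro: stream.expand)
          have "act G (ed e * a * gh e) \<phi> x = tpow 1 * act G a (letter_act G (Ghost e) \<phi>) (stl x)"
            using True by (simp add: act_mult del: bpath_Stream_Inl letter_act.simps(3))
          then show ?thesis
            unfolding g using True x by (simp add: tpow_mult_left del: bpath_Stream_Inl)
        qed (use \<phi> in \<open>auto simp: act_mult\<close>)
      qed
      then show ?thesis using a e Inl True
        by (intro bexI[of _ "ed e * a * gh e"] exI[of _ "{x. shd x = Inl e \<and> stl x \<in> S}"]) auto
    qed
  qed
qed


lemma cylinder_separates_finite:
  assumes "finite D" "bpath G p" "p \<notin> D" "\<And>q. q \<in> D \<Longrightarrow> bpath G q"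
  shows "\<exists>a\<in>unital_free_alg (lpa_gens G). \<exists>S. p \<in> S \<and> S \<inter> D = {} \<and>
    (\<forall>\<phi>. (\<forall>x. \<not> bpath G x \<longrightarrow> \<phi> x = 0) \<longrightarrow>
      act G a \<phi> = (\<lambda>x. if x \<in> S then \<phi> x else (0 :: 'k::field laurent)))"
  using assms
proof (induction D rule: finite_induct)
  case empty
  show ?case by (intro bexI[of _ 1] exI[of _ UNIV]) auto
next
  case (insert q D)
  obtain a S where a: "a \<in> unital_free_alg (lpa_gens G)" "p \<in> S" "S \<inter> D = {}"
    and S: "\<And>\<phi>. (\<forall>x. \<not> bpath G x \<longrightarrow> \<phi> x = 0) \<Longrightarrow>
      act G a \<phi> = (\<lambda>x. if x \<in> S then \<phi> x else (0 :: 'k laurent))"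
    using insert.IH insert.prems by auto
  have "p \<noteq> q" using insert.prems by auto
  then obtain n where n: "snth p n \<noteq> snth q n" by (metis ext stream_smap_nats)
  obtain b T where b: "b \<in> unital_free_alg (lpa_gens G)" "p \<in> T" "q \<notin> T"
    and T: "\<And>\<phi>. (\<forall>x. \<not> bpath G x \<longrightarrow> \<phi> x = 0) \<Longrightarrow>
      act G b \<phi> = (\<lambda>x. if x \<in> T then \<phi> x else (0 :: 'k laurent))"
    using cylinder_separates_points[OF insert.prems(1) insert.prems(3)[of q] n] by auto
  have "act G (a * b) \<phi> = (\<lambda>x. if x \<in> S \<inter> T then \<phi> x else 0)"
    if \<phi>: "\<forall>x. \<not> bpath G x \<longrightarrow> \<phi> x = 0" for \<phi> :: "_ \<Rightarrow> 'k laurent"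
    using \<phi> by (simp add: act_mult T[OF \<phi>]) (subst S; auto)
  then show ?case using a b by (intro bexI[of _ "a * b"] exI[of _ "S \<inter> T"]) auto
qed

end

lemma act_power_delta:
  assumes "act G a (delta p) = (\<lambda>x. tpow n * delta p x)"
  shows "act G (a ^ k) (delta p) = (\<lambda>x. tpow (int k * n) * delta p x)"
proof (induction k)
  case (Suc k)
  show ?case
    by (simp only: power_Suc act_mult Suc act_scale_arg assms tpow_mult_left)
      (simp add: algebra_simps)
qed simp

section \<open>Eigenvalues and the failure of quasi-regularity\<close>

context leavitt
begin

lemma normalize_eigenvalue:
  assumes f: "f \<noteq> 0"
    and lag: "\<And>n. n \<in> Poly_Mapping.keys f \<Longrightarrow> \<exists>l\<in>U. \<exists>l'\<in>U.
      act G l (delta p) = (\<lambda>x. tpow n * delta p x) \<and> act G l' (delta p) = (\<lambda>x. tpow (- n) * delta p x)"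
  shows "\<exists>b\<in>U. \<exists>h. act G b (delta p) = (\<lambda>x. h * delta p x) \<and> (\<forall>u. (1 - h * f) * u \<noteq> (1 :: 'k laurent))"
proof (cases "Poly_Mapping.keys f \<subseteq> {0}")
  case True
  define c where "c = Poly_Mapping.lookup f 0"
  have fc: "f = lconst c"
    using True by (intro poly_mapping_eqI) (auto simp: c_def lookup_single when_def in_keys_iff)
  then have "c \<noteq> 0" using f by auto
  then have "lconst (1 / c) * f = 1" by (simp add: fc mult_single)
  then show ?thesis by (intro bexI[of _ "scalar (1 / c)"] exI[of _ "lconst (1 / c)"]) auto
next
  case False
  then obtain n where n: "n \<in> Poly_Mapping.keys f" "n \<noteq> 0" by blast
  \<comment> \<open>Of the shifts by \<open>n\<close> and by \<open>- n\<close>, the one with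
    positive exponent.\<close>
  obtain l m where l: "l \<in> U" "act G l (delta p) = (\<lambda>x. tpow m * delta p x :: 'k laurent)" "m > 0"
    using lag[OF n(1)] n(2) by (metis neg_0_less_iff_less linorder_neqE_linordered_idom)
  \<comment> \<open>As \<open>m\<close> is at least 1, \<open>k\<close> shifts raise the lowest
    exponent to at least 1; \<open>nat\<close> gives no shift if it is positive already.\<close>
  define k where "k = nat (1 - Min (Poly_Mapping.keys f))"
  have k: "int k * m + i > 0" if "i \<in> Poly_Mapping.keys f" for i
  proof -
    have "Min (Poly_Mapping.keys f) \<le> i" using that by simp
    then have "int k \<ge> 1 - i" by (simp add: k_def)
    moreover have "int k * m \<ge> int k * 1" using l(3) by (intro mult_left_mono) auto
    ultimately show ?thesis by linarith
  qed
  have "(1 - tpow (int k * m) * f) * u \<noteq> 1" for u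
  proof (rule Laurent_one_minus_not_unit)
    show "i > 0" if "i \<in> Poly_Mapping.keys (tpow (int k * m) * f)" for i
      using k[of "i - int k * m"] that by (simp add: keys_tpow_mult)
    have "n + int k * m \<in> Poly_Mapping.keys (tpow (int k * m) * f)"
      using n(1) by (simp add: keys_tpow_mult)
    then show "tpow (int k * m) * f \<noteq> 0" by auto
  qed
  then show ?thesis
    using l(1) act_power_delta[OF l(2), of k]
    by (intro bexI[of _ "l ^ k"] exI[of _ "tpow (int k * m)"]) (auto intro: unital_free_alg_power)
qed

lemma not_quasiregular_multiple:
  assumes a: "a \<in> carrier (free_alg TYPE('k) (lpa_gens G))" "a \<notin> I"
  shows "\<exists>c\<in>carrier (free_alg TYPE('k) (lpa_gens G)). \<exists>p g.
    act G (c * a) (delta p) = (\<lambda>x. g * delta p x) \<and> (\<forall>u. (1 - g) * u \<noteq> (1 :: 'k laurent))"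
proof -
  let ?w = "\<lambda>w. Poly_Mapping.single w (1 :: 'k)"
  obtain p where p: "bpath G p" and ap: "act G a (delta p) \<noteq> (\<lambda>x. 0 :: 'k laurent)"
    using act_faithful[OF a(1)] a(2) by blast
  define \<phi> :: "_ \<Rightarrow> 'k laurent" where "\<phi> = act G a (delta p)"
  have \<phi>_sum: "\<phi> x = (\<Sum>w\<in>Poly_Mapping.keys a. lconst (Poly_Mapping.lookup a w) * word_act G (letters w) (delta p) x)" for x
    by (simp add: \<phi>_def act_def)
  have word: "letters w \<noteq> []" "set (letters w) \<subseteq> lpa_gens G" if "w \<in> Poly_Mapping.keys a" for w
    using a(1) that by (auto simp: free_alg_def)
  have supp: "\<forall>x. \<not> bpath G x \<longrightarrow> \<phi> x = 0"
    using word(1) by (auto simp: \<phi>_sum word_act_support)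
  have "finite {x. word_act G w (delta p) x \<noteq> (0 :: 'k laurent)}" for w
  proof -
    obtain n q where "word_act G w (delta p) = (\<lambda>x. 0 :: 'k laurent) \<or>
        word_act G w (delta p) = (\<lambda>x. tpow n * delta q x :: 'k laurent)"
      using word_act_delta[OF p, of w] by blast
    then have "{x. word_act G w (delta p) x \<noteq> (0 :: 'k laurent)} \<subseteq> {q}" by (auto simp: delta_def split: if_splits)
    then show ?thesis using finite_subset by blast
  qed
  then have "finite (\<Union>w\<in>Poly_Mapping.keys a. {x. word_act G (letters w) (delta p) x \<noteq> (0 :: 'k laurent)})"
    by simp
  moreover have "{x. \<phi> x \<noteq> 0} \<subseteq> \<dots>"
    unfolding \<phi>_sum using sum.not_neutral_contains_not_neutral by fastforce
  ultimately have fin: "finite {x. \<phi> x \<noteq> 0}" by (rule finite_subset[rotated])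
  obtain q where q0: "\<phi> q \<noteq> 0" using ap by (auto simp: \<phi>_def)
  then have q: "bpath G q" using supp by blast
  have words: "\<exists>n. word_act G (letters w) (delta p) = (\<lambda>x. tpow n * delta q x :: 'k laurent) \<and>
      word_act G (star (letters w)) (delta q) = (\<lambda>x. tpow (- n) * delta p x :: 'k laurent)"
    if "word_act G (letters w) (delta p) q \<noteq> (0 :: 'k laurent)" for w
    using word_act_delta[OF p, of "letters w"] that by (auto simp: delta_def fun_eq_iff split: if_splits)
  have wU: "?w w \<in> U" "?w (Word (star (letters w))) \<in> carrier (free_alg TYPE('k) (lpa_gens G))"
    if "w \<in> Poly_Mapping.keys a" for w
    using word[OF that] star_gens by (auto simp: unital_free_alg_def free_alg_def star_def)
  obtain w where w: "w \<in> Poly_Mapping.keys a" "word_act G (letters w) (delta p) q \<noteq> (0 :: 'k laurent)"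
  proof -
    obtain w where "w \<in> Poly_Mapping.keys a"
      "lconst (Poly_Mapping.lookup a w) * word_act G (letters w) (delta p) q \<noteq> (0 :: 'k laurent)"
      using q0 unfolding \<phi>_sum by (rule sum.not_neutral_contains_not_neutral)
    then show ?thesis using that by auto
  qed
  obtain m where m: "word_act G (letters w) (delta p) = (\<lambda>x. tpow m * delta q x :: 'k laurent)"
      "word_act G (star (letters w)) (delta q) = (\<lambda>x. tpow (- m) * delta p x :: 'k laurent)"
    using words[OF w(2)] by blast
  \<comment> \<open>The reversed word brings \<open>q\<close> back to \<open>p\<close>. It is
    nonempty, so \<open>d * b * E\<close> below has no constant term although \<open>d\<close> and
    \<open>E\<close> may have one.\<close>
  define b where "b = ?w (Word (star (letters w)))"
  have b: "b \<in> carrier (free_alg TYPE('k) (lpa_gens G))" using wU(2)[OF w(1)] by (simp add: b_def)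
  have bq: "act G b (delta q) = (\<lambda>x. tpow (- m) * delta p x)"
    by (simp add: b_def act_single m(2))
  obtain E S where E: "E \<in> U" "q \<in> S" "S \<inter> ({x. \<phi> x \<noteq> 0} - {q}) = {}"
    and S: "act G E \<phi> = (\<lambda>x. if x \<in> S then \<phi> x else 0)"
    using cylinder_separates_finite[of "{x. \<phi> x \<noteq> 0} - {q}" q] fin q supp by blast
  have E\<phi>: "act G E \<phi> = (\<lambda>x. \<phi> q * delta q x)"
    unfolding S using E(2,3) by (auto simp: fun_eq_iff delta_def)
  have "act G (b * E * a) (delta p) = act G b (act G E \<phi>)" by (simp add: act_mult \<phi>_def)
  then have bEa: "act G (b * E * a) (delta p) = (\<lambda>x. (tpow (- m) * \<phi> q) * delta p x)"
    by (simp add: E\<phi> act_scale_arg bq mult_ac)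
  define f where "f = tpow (- m) * \<phi> q"
  have "tpow m * f = \<phi> q" by (simp add: f_def tpow_mult_left)
  then have f0: "f \<noteq> 0" using q0 by auto
  \<comment> \<open>An exponent \<open>n\<close> of \<open>f\<close> comes from a word
    \<open>u\<close> of \<open>a\<close> taking \<open>p\<close> to \<open>q\<close> with exponent
    \<open>n + m\<close>. Going out by \<open>u\<close> and back by the reverse of \<open>w\<close>
    shifts by \<open>n\<close>; going out by \<open>w\<close> and back by the reverse of
    \<open>u\<close> shifts by \<open>- n\<close>.\<close>
  have lag: "\<exists>l\<in>U. \<exists>l'\<in>U. act G l (delta p) = (\<lambda>x. tpow n * delta p x :: 'k laurent) \<and>
      act G l' (delta p) = (\<lambda>x. tpow (- n) * delta p x :: 'k laurent)"
    if n: "n \<in> Poly_Mapping.keys f" for n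
  proof -
    have "n + m \<in> Poly_Mapping.keys (\<phi> q)" using n by (simp add: f_def keys_tpow_mult)
    then obtain u where u: "u \<in> Poly_Mapping.keys a" and
      nm: "n + m \<in> Poly_Mapping.keys (lconst (Poly_Mapping.lookup a u) * word_act G (letters u) (delta p) q)"
      unfolding \<phi>_sum by (rule UN_E[OF subsetD[OF keys_sum]])
    then have "word_act G (letters u) (delta p) q \<noteq> (0 :: 'k laurent)" by auto
    from words[OF this] obtain i where
      i: "word_act G (letters u) (delta p) = (\<lambda>x. tpow i * delta q x :: 'k laurent)"
      "word_act G (star (letters u)) (delta q) = (\<lambda>x. tpow (- i) * delta p x :: 'k laurent)" by blast
    have "n + m = i" using nm by (simp add: i delta_def mult_single split: if_splits)
    then have "act G (b * ?w u) (delta p) = (\<lambda>x. tpow n * delta p x :: 'k laurent)"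
      "act G (?w (Word (star (letters u))) * ?w w) (delta p) = (\<lambda>x. tpow (- n) * delta p x :: 'k laurent)"
      by (auto simp: act_mult act_single act_scale_arg word_act_scale i m bq tpow_mult_left)
    moreover have "b * ?w u \<in> U" "?w (Word (star (letters u))) * ?w w \<in> U"
      using b wU u w free_alg_unital by blast+
    ultimately show ?thesis by blast
  qed
  obtain d h where d: "d \<in> U" "act G d (delta p) = (\<lambda>x. h * delta p x)"
    and h: "\<forall>u. (1 - h * f) * u \<noteq> (1 :: 'k laurent)"
    using normalize_eigenvalue[OF f0 lag] by blast
  have "act G (d * b * E * a) (delta p) = act G d (act G (b * E * a) (delta p))"
    by (simp add: act_mult)
  also have "\<dots> = (\<lambda>x. (h * f) * delta p x)"
    unfolding bEa[folded f_def] act_scale_arg d(2) by (simp add: mult_ac)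
  finally show ?thesis
    using h b d(1) E(1) by (intro bexI[of _ "d * b * E"] exI[of _ p] exI[of _ "h * f"]) auto
qed

end

theorem theorem2p12:
  fixes G :: "('v, 'e) ultragraph"
  assumes "ultragraph G"
  shows "jacobson_radical (leavitt_path_algebra TYPE('k::field) G)
       = {\<zero>\<^bsub>leavitt_path_algebra TYPE('k) G\<^esub>}"
proof -
  interpret ultragraph G by fact
  interpret leavitt G "TYPE('k)" ..
  let ?A = "free_alg TYPE('k) (lpa_gens G)"
  interpret A: nonunital_ideal ?A I
    by (rule nonunital_ideal_alg_ideal[OF lpa_relations_subset])
  have L: "leavitt_path_algebra TYPE('k) G = ?A Quot I" by (simp add: leavitt_path_algebra_def)
  interpret L: nonunital_ring "?A Quot I" by (rule A.nonunital_ring_Quot)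
  have zero: "\<zero>\<^bsub>?A Quot I\<^esub> = I" by (simp add: FactRing_def)
  have "X = I" if X: "X \<in> jacobson_radical (?A Quot I)" for X
  proof -
    have "X \<in> carrier (?A Quot I)" using X by (simp add: jacobson_radical_def)
    then obtain a where a: "a \<in> carrier ?A" and Xa: "X = I +>\<^bsub>?A\<^esub> a"
      by (auto simp: A.carrier_Quot)
    have "a \<in> I"
    proof (rule ccontr)
      assume "a \<notin> I"
      with a obtain c p g where c: "c \<in> carrier ?A"
        and ca: "act G (c * a) (delta p) = (\<lambda>x. g * delta p x)"
        and g: "\<And>u. (1 - g) * u \<noteq> (1 :: 'k laurent)"
        using not_quasiregular_multiple by blast
      have "I +>\<^bsub>?A\<^esub> c \<in> carrier (?A Quot I)" using c by (auto simp: A.carrier_Quot)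
      from L.jacobson_radical_left_quasiregular[OF X this]
      obtain y where y: "y \<in> carrier ?A" and
        "(I +>\<^bsub>?A\<^esub> y) \<oplus>\<^bsub>?A Quot I\<^esub> ((I +>\<^bsub>?A\<^esub> c) \<otimes>\<^bsub>?A Quot I\<^esub> X) =
         (I +>\<^bsub>?A\<^esub> y) \<otimes>\<^bsub>?A Quot I\<^esub> ((I +>\<^bsub>?A\<^esub> c) \<otimes>\<^bsub>?A Quot I\<^esub> X)"
        by (auto simp: A.carrier_Quot)
      moreover have ca': "c * a \<in> carrier ?A" using A.mult_closed[OF c a] by simp
      moreover have "y * (c * a) \<in> carrier ?A" using A.mult_closed[OF y ca'] by simp
      ultimately have "I +>\<^bsub>?A\<^esub> (y + c * a) = I +>\<^bsub>?A\<^esub> (y * (c * a))"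
        using c a A.Quot_mult[OF c a] A.Quot_add[OF y ca'] A.Quot_mult[OF y ca'] by (simp add: Xa)
      moreover have "y + c * a \<in> I +>\<^bsub>?A\<^esub> (y + c * a)"
        using A.a_rcos_self[of "y + c * a"] free_alg_closed(3)[OF y ca'] by simp
      ultimately obtain i where "i \<in> I" "y + c * a = i + y * (c * a)"
        by (auto simp: a_r_coset_def')
      then have y_ca: "y + c * a \<approx> y * (c * a)" by (simp add: eqv_def)
      have dpp: "delta p p = (1 :: 'k laurent)" by (simp add: delta_def)
      \<comment> \<open>The image of \<open>delta p\<close> under \<open>y\<close> may spread over
        several paths, but its value at \<open>p\<close> is enough: the action is linear over
        Laurent polynomials, so \<open>g\<close> factors out of the right-hand side.\<close>
      from fun_cong[OF eqv_act[OF y_ca, of "delta p"], of p]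
      have "act G y (delta p) p + g = g * act G y (delta p) p"
        by (simp add: act_add act_mult[of G y] ca act_scale_arg dpp)
      \<comment> \<open>The quasi-inverse \<open>y\<close> yields
        \<open>1 - act G y (delta p) p\<close> as an inverse of \<open>1 - g\<close>.\<close>
      then have "(1 - g) * (1 - act G y (delta p) p) = 1" by (simp add: algebra_simps)
      then show False using g by blast
    qed
    then show ?thesis unfolding Xa by (rule A.a_coset_join2[OF a A.a_subgroup])
  qed
  then show ?thesis using L.zero_in_jacobson_radical unfolding L zero by blast
qed

end
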